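(* For all integers $n\ge2$, all real $\theta$ with $\pi/3\le\theta\le\pi$, and all $r>0$, $$\Delta_{\mathbb{H}^n}(r)\le \sin^{n-1}(\theta/2)\,A(n,\theta).$$
   Context: $A(n,\theta)$ is the greatest size of a set of points on the unit sphere in $\mathbb{R}^n$ such that $\langle x,y\rangle\le\cos\theta$ for all pairs of distinct points $x,y$ in the set. $\mathbb{H}^n$ is $n$-dimensional hyperbolic space (curvature $-1$). $\Delta_{\mathbb{H}^n}(r)$ is the optimal packing density, in the sense of Bowen and Radin, for balls of radius $r$ in $\mathbb{H}^n$, defined as follows. Let $S_r$ be the space of relatively dense packings of $\mathbb{H}^n$ by closed balls of radius $r$: collections of closed balls of radius $r$ with pairwise disjoint interiors such that any additional ball of radius $r$ would intersect a ball of the packing. $S_r$ carries a natural metric making it compact; it induces the topology of local Hausdorff convergence (uniform convergence on compact sets) of packings, and its Borel $\sigma$-algebra is the one generated by the functions counting the sphere centers of a packing lying in a given Borel subset of $\mathbb{H}^n$. The isometry group $G$ of $\mathbb{H}^n$ acts on $S_r$. For a $G$-invariant Borel probability measure $\mu$ on $S_r$, the density of $\mu$ is the probability that a fixed origin in $\mathbb{H}^n$ is contained in one of the balls of a $\mu$-random packing (by $G$-invariance this does not depend on the origin). $\Delta_{\mathbb{H}^n}(r)$ is the least upper bound of the densities of all $G$-invariant Borel probability measures on $S_r$. *)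

theory Defs
  imports "HOL-Probability.Probability"
begin

text \<open>
  Hyperbolic \<open>n\<close>-space of curvature \<open>-1\<close>, \<open>n = CARD('n)\<close>, as the upper sheet of the hyperboloid in
  Minkowski space \<open>real^'n \<times> real\<close>, the last coordinate being the timelike one.
\<close>

definition minkowski :: "(real^'n) \<times> real \<Rightarrow> (real^'n) \<times> real \<Rightarrow> real" where
  "minkowski p q = snd p * snd q - fst p \<bullet> fst q"

typedef (overloaded) 'n hyperbolic = "{p :: (real^'n) \<times> real. minkowski p p = 1 \<and> snd p > 0}"
  by (rule exI[of _ "(0, 1)"]) (simp add: minkowski_def)

definition hyp_dist :: "(real^'n) \<times> real \<Rightarrow> (real^'n) \<times> real \<Rightarrow> real" where
  "hyp_dist p q = arcosh (minkowski p q)"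

lemma minkowski_commute: "minkowski p q = minkowski q p"
  by (simp add: minkowski_def inner_commute mult.commute)

lemma minkowski_ge_1:
  assumes "minkowski p p = 1" "snd p > 0" "minkowski q q = 1" "snd q > 0"
  shows "minkowski p q \<ge> 1" and "minkowski p q = 1 \<Longrightarrow> p = q"
proof -
  obtain a s b t where pq: "p = (a, s)" "q = (b, t)" by (metis surj_pair)
  define A B where "A = norm a" and "B = norm b"
  have s: "s\<^sup>2 = 1 + A\<^sup>2" "s > 0" and t: "t\<^sup>2 = 1 + B\<^sup>2" "t > 0"
    using assms unfolding pq minkowski_def A_def B_def power2_norm_eq_inner
    by (auto simp: power2_eq_square)
  have cs: "a \<bullet> b \<le> A * B" unfolding A_def B_def by (rule norm_cauchy_schwarz)
  have AB: "A \<ge> 0" "B \<ge> 0" by (auto simp: A_def B_def)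
  have sq: "(s * t)\<^sup>2 = (1 + A * B)\<^sup>2 + (A - B)\<^sup>2"
    using s t by (simp add: power_mult_distrib) (simp add: power2_eq_square algebra_simps)
  have st: "s * t \<ge> 1 + A * B"
    by (rule power2_le_imp_le) (use sq s t in auto)
  show "minkowski p q \<ge> 1" using st cs by (simp add: pq minkowski_def)
  assume "minkowski p q = 1"
  hence eq: "s * t = 1 + a \<bullet> b" by (simp add: pq minkowski_def)
  with st cs have "s * t = 1 + A * B" and ab: "a \<bullet> b = A * B" by auto
  with sq have "A = B" by simp
  hence "s = t" using s t by (metis less_eq_real_def power2_eq_imp_eq)
  moreover have "a \<bullet> a = A * A" "b \<bullet> b = B * B"
    by (simp_all add: A_def B_def power2_norm_eq_inner[symmetric] power2_eq_square)
  hence "a = b" using ab \<open>A = B\<close> by (simp add: vector_eq[of a b])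
  ultimately show "p = q" by (simp add: pq)
qed

lemma minkowski_cauchy_schwarz:
  assumes p: "minkowski p p = 1" and q: "minkowski q q = 1" "snd q > 0" and r: "minkowski r r = 1"
  shows "(minkowski p q * minkowski q r - minkowski p r)\<^sup>2
           \<le> ((minkowski p q)\<^sup>2 - 1) * ((minkowski q r)\<^sup>2 - 1)"
proof -
  obtain a s b t c u where pqr: "p = (a, s)" "q = (b, t)" "r = (c, u)" by (metis surj_pair)
  define \<alpha> \<gamma> where "\<alpha> = minkowski p q" and "\<gamma> = minkowski q r"
  define Q where "Q v w = t\<^sup>2 * (v \<bullet> w) - (v \<bullet> b) * (w \<bullet> b)" for v w :: "real^'a"
  have s: "s * s - a \<bullet> a = 1" and t: "t * t - b \<bullet> b = 1" "t > 0" and u: "u * u - c \<bullet> c = 1"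
    using p q r by (auto simp: pqr minkowski_def)
  have \<alpha>: "a \<bullet> b = s * t - \<alpha>" and \<gamma>: "c \<bullet> b = u * t - \<gamma>"
    by (auto simp: \<alpha>_def \<gamma>_def pqr minkowski_def inner_commute)
  have Qge: "Q v v \<ge> v \<bullet> v" for v
  proof -
    have "(v \<bullet> b)\<^sup>2 \<le> (v \<bullet> v) * (b \<bullet> b)" by (rule Cauchy_Schwarz_ineq)
    moreover have "t\<^sup>2 = 1 + b \<bullet> b" using t by (simp add: power2_eq_square)
    ultimately show ?thesis by (simp add: Q_def power2_eq_square algebra_simps)
  qed
  have CS: "(Q v w)\<^sup>2 \<le> Q v v * Q w w" for v w
  proof (cases "w = 0")
    case True
    then show ?thesis by (simp add: Q_def)
  next
    case False
    hence pos: "Q w w > 0" using Qge[of w] by (smt (verit) inner_gt_zero_iff)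
    define l where "l = Q v w / Q w w"
    have "0 \<le> Q (v - l *\<^sub>R w) (v - l *\<^sub>R w)"
      using Qge[of "v - l *\<^sub>R w"] by (smt (verit) inner_ge_zero)
    also have "\<dots> = Q v v - 2 * l * Q v w + l\<^sup>2 * Q w w"
      by (simp add: Q_def inner_diff inner_commute power2_eq_square algebra_simps)
    also have "\<dots> = Q v v - (Q v w)\<^sup>2 / Q w w"
      using pos by (simp add: l_def power2_eq_square field_simps)
    finally show ?thesis using pos by (simp add: field_simps)
  qed
  have aa: "a \<bullet> a = s * s - 1" and bb: "b \<bullet> b = t * t - 1" and cc: "c \<bullet> c = u * u - 1"
    using s t u by auto
  have ac: "a \<bullet> c = s * u - minkowski p r" by (simp add: pqr minkowski_def)
  have ba: "b \<bullet> a = s * t - \<alpha>" and bc: "b \<bullet> c = u * t - \<gamma>" and ca: "c \<bullet> a = s * u - minkowski p r"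
    using \<alpha> \<gamma> ac by (auto simp: inner_commute)
  have 1: "Q (a - \<alpha> *\<^sub>R b) (c - \<gamma> *\<^sub>R b) = t\<^sup>2 * (\<alpha> * \<gamma> - minkowski p r)"
    unfolding Q_def by (simp add: inner_diff aa bb cc ac \<alpha> \<gamma> ba bc) (simp add: power2_eq_square algebra_simps)
  have 2: "Q (a - \<alpha> *\<^sub>R b) (a - \<alpha> *\<^sub>R b) = t\<^sup>2 * (\<alpha>\<^sup>2 - 1)"
    unfolding Q_def by (simp add: inner_diff aa bb cc ac \<alpha> \<gamma> ba bc) (simp add: power2_eq_square algebra_simps)
  have 3: "Q (c - \<gamma> *\<^sub>R b) (c - \<gamma> *\<^sub>R b) = t\<^sup>2 * (\<gamma>\<^sup>2 - 1)"
    unfolding Q_def by (simp add: inner_diff aa bb cc ac \<alpha> \<gamma> ba bc) (simp add: power2_eq_square algebra_simps)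
  have "(t\<^sup>2)\<^sup>2 * (\<alpha> * \<gamma> - minkowski p r)\<^sup>2 \<le> (t\<^sup>2)\<^sup>2 * ((\<alpha>\<^sup>2 - 1) * (\<gamma>\<^sup>2 - 1))"
    using CS[of "a - \<alpha> *\<^sub>R b" "c - \<gamma> *\<^sub>R b"] unfolding 1 2 3
    by (simp only: power_mult_distrib power2_eq_square mult_ac)
  moreover have "(t\<^sup>2)\<^sup>2 > 0" using t by simp
  ultimately have "(\<alpha> * \<gamma> - minkowski p r)\<^sup>2 \<le> (\<alpha>\<^sup>2 - 1) * (\<gamma>\<^sup>2 - 1)"
    by (meson mult_le_cancel_left_pos)
  thus ?thesis by (simp add: \<alpha>_def \<gamma>_def)
qed

lemma hyp_dist_triangle:
  assumes p: "minkowski p p = 1" "snd p > 0" and q: "minkowski q q = 1" "snd q > 0"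
    and r: "minkowski r r = 1" "snd r > 0"
  shows "hyp_dist p r \<le> hyp_dist p q + hyp_dist q r"
proof -
  define \<alpha> \<beta> \<gamma> where "\<alpha> = minkowski p q" and "\<beta> = minkowski p r" and "\<gamma> = minkowski q r"
  have ge: "\<alpha> \<ge> 1" "\<beta> \<ge> 1" "\<gamma> \<ge> 1"
    unfolding \<alpha>_def \<beta>_def \<gamma>_def using minkowski_ge_1(1) p q r by blast+
  have "(\<alpha> * \<gamma> - \<beta>)\<^sup>2 \<le> (\<alpha>\<^sup>2 - 1) * (\<gamma>\<^sup>2 - 1)"
    unfolding \<alpha>_def \<beta>_def \<gamma>_def by (rule minkowski_cauchy_schwarz) (use p q r in auto)
  hence "\<bar>\<alpha> * \<gamma> - \<beta>\<bar> \<le> sqrt ((\<alpha>\<^sup>2 - 1) * (\<gamma>\<^sup>2 - 1))"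
    using real_le_rsqrt by (metis power2_abs)
  hence "\<beta> \<le> \<alpha> * \<gamma> + sqrt (\<alpha>\<^sup>2 - 1) * sqrt (\<gamma>\<^sup>2 - 1)"
    by (simp add: real_sqrt_mult)
  also have "\<dots> = cosh (arcosh \<alpha> + arcosh \<gamma>)"
    using ge by (simp add: cosh_add sinh_arcosh_real)
  finally have "cosh (arcosh \<beta>) \<le> cosh (arcosh \<alpha> + arcosh \<gamma>)"
    using ge by simp
  moreover have "arcosh \<alpha> \<ge> 0" "arcosh \<beta> \<ge> 0" "arcosh \<gamma> \<ge> 0" using ge by auto
  ultimately show ?thesis
    by (simp add: hyp_dist_def \<alpha>_def \<beta>_def \<gamma>_def cosh_real_nonneg_le_iff)
qed

instantiation hyperbolic :: (finite) metric_space
begin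

definition dist_hyperbolic :: "'a hyperbolic \<Rightarrow> 'a hyperbolic \<Rightarrow> real" where
  "dist_hyperbolic x y = hyp_dist (Rep_hyperbolic x) (Rep_hyperbolic y)"

definition uniformity_hyperbolic :: "('a hyperbolic \<times> 'a hyperbolic) filter" where
  "uniformity_hyperbolic = (INF e\<in>{0 <..}. principal {(x, y). dist x y < e})"

definition open_hyperbolic :: "'a hyperbolic set \<Rightarrow> bool" where
  "open_hyperbolic U \<longleftrightarrow>
     (\<forall>x\<in>U. eventually (\<lambda>(x', y). x' = x \<longrightarrow> y \<in> U) (uniformity :: ('a hyperbolic \<times> 'a hyperbolic) filter))"

instance
proof
  fix x y z :: "'a hyperbolic"
  note R = Rep_hyperbolic[simplified]
  show "dist x y = 0 \<longleftrightarrow> x = y"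
  proof
    assume "dist x y = 0"
    hence "arcosh (minkowski (Rep_hyperbolic x) (Rep_hyperbolic y)) = 0"
      by (simp add: dist_hyperbolic_def hyp_dist_def)
    hence "cosh 0 = minkowski (Rep_hyperbolic x) (Rep_hyperbolic y)"
      using minkowski_ge_1(1) R by (metis cosh_arcosh_real)
    hence "Rep_hyperbolic x = Rep_hyperbolic y"
      using minkowski_ge_1(2) R by (metis cosh_0)
    thus "x = y" by (simp add: Rep_hyperbolic_inject)
  next
    assume "x = y"
    thus "dist x y = 0" using R[of y]
      by (simp add: dist_hyperbolic_def hyp_dist_def)
  qed
  have "dist a b = dist b a" for a b :: "'a hyperbolic"
    by (simp add: dist_hyperbolic_def hyp_dist_def minkowski_commute)
  moreover have "dist x y \<le> dist x z + dist z y"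
    unfolding dist_hyperbolic_def by (rule hyp_dist_triangle) (use R in auto)
  ultimately show "dist x y \<le> dist x z + dist y z" by metis
qed (simp_all add: uniformity_hyperbolic_def open_hyperbolic_def)

end

definition hyp_origin :: "'n::finite hyperbolic" where
  "hyp_origin = Abs_hyperbolic (0, 1)"

definition hyp_isometries :: "('n::finite hyperbolic \<Rightarrow> 'n hyperbolic) set" where
  "hyp_isometries = {g. bij g \<and> (\<forall>x y. dist (g x) (g y) = dist x y)}"

text \<open>The space \<open>S\<^sub>r\<close>: a packing is the set of its balls, each ball being a set of points.\<close>

definition dense_packings :: "real \<Rightarrow> 'n::finite hyperbolic set set set" where
  "dense_packings r =
     {P. P \<subseteq> range (\<lambda>x. cball x r) \<and>
         pairwise (\<lambda>B C. interior B \<inter> interior C = {}) P \<and>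
         (\<forall>x. cball x r \<notin> P \<longrightarrow> (\<exists>B\<in>P. cball x r \<inter> B \<noteq> {}))}"

definition centers :: "real \<Rightarrow> 'n::finite hyperbolic set set \<Rightarrow> 'n hyperbolic set" where
  "centers r P = {x. cball x r \<in> P}"

text \<open>
  The measurable space \<open>S\<^sub>r\<close>, with the \<open>\<sigma>\<close>-algebra generated by the functions (with values in
  \<open>{0, 1, 2, \<dots>, \<infinity>}\<close>) that count the centers in a given Borel set.
\<close>

definition packing_space :: "real \<Rightarrow> 'n::finite hyperbolic set set measure" where
  "packing_space r = sigma (dense_packings r)
     {(\<lambda>P. emeasure (count_space UNIV) (centers r P \<inter> B)) -` A \<inter> dense_packings r | A B.
        A \<in> sets borel \<and> B \<in> sets borel}"

definition invariant_prob_measures :: "real \<Rightarrow> 'n::finite hyperbolic set set measure set" where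
  "invariant_prob_measures r =
     {\<mu>. prob_space \<mu> \<and> sets \<mu> = sets (packing_space r) \<and>
         (\<forall>g\<in>hyp_isometries. distr \<mu> \<mu> (\<lambda>P. (\<lambda>B. g ` B) ` P) = \<mu>)}"

definition packing_density :: "'n::finite hyperbolic set set measure \<Rightarrow> ennreal" where
  "packing_density \<mu> = emeasure \<mu> {P \<in> space \<mu>. hyp_origin \<in> \<Union>P}"

definition optimal_packing_density :: "'n::finite itself \<Rightarrow> real \<Rightarrow> ennreal" where
  "optimal_packing_density _ r =
     (SUP \<mu> \<in> (invariant_prob_measures r :: 'n hyperbolic set set measure set). packing_density \<mu>)"

definition spherical_codes :: "real \<Rightarrow> (real^'n) set set" where
  "spherical_codes \<theta> = {C. C \<subseteq> sphere 0 1 \<and> pairwise (\<lambda>x y. x \<bullet> y \<le> cos \<theta>) C}"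

text \<open>
  \<open>A(n, \<theta>)\<close> for \<open>n = CARD('n)\<close>. The maximum exists for \<open>0 < \<theta> \<le> \<pi>\<close>: by compactness of the sphere
  codes are then finite and of bounded size.
\<close>

definition max_code_size :: "'n::finite itself \<Rightarrow> real \<Rightarrow> nat" where
  "max_code_size _ \<theta> = (GREATEST k. \<exists>C \<in> (spherical_codes \<theta> :: (real^'n) set set). finite C \<and> card C = k)"

end

(*
The expected number of centers in a Borel set is an isometry-invariant measure N on hyperbolic space,
hence proportional to the volume M, since both give equal mass to balls of equal radius. Put
s = sin(theta/2) and sinh R = sinh(r)/s, so that two points at distance R from the origin seen under
the angle theta are at distance 2r. As theta >= pi/3, the directions of the centers in a ball of
radius R form a spherical code, so N(B_R) <= A(n,theta), while the density is at most
N(B_r) = N(B_R) M(B_r)/M(B_R). Comparing the two volumes slice by slice yields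
M(B_r) <= s^(n-1) M(B_R).
*)

theory Submission
  imports Defs
begin

text \<open>Proportionality of N and M comes from a Fubini estimate applied with the two measures in
  both roles. It asks only for finite mass of small balls, equal for equal radii and positive for M.
  Isometries carrying the origin to any given point supply the equality; Lorentz boosts do this. M
  is modelled by Lebesgue measure of the cone below the hyperboloid, so that its invariance is
  linear algebra and its slices over space are intervals. The exponent n - 1 arises as follows: y ->
  y/s takes the spatial shadow of the small cone onto that of the large one and scales volume by
  s^-n, while a slice may shrink by a factor s. The bound pi/3 acts twice. By cos theta <= 1/2, two
  points on the sphere of radius R are the extreme case of the law of cosines. By sin(theta/2) >=
  1/2, R <= 2r, so that a center at the origin, which has no direction, is the only center in the
  open ball. Fubini compares open sets, whereas covering the origin concerns a closed ball; hence a
  final limit from outside.\<close>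

section \<open>Uniformly distributed measures\<close>

lemma sigma_finite_measure_balls:
  fixes M :: "'a::{metric_space,second_countable_topology} measure"
  assumes sets: "sets M = sets borel" and "\<rho> > 0"
    and fin: "\<And>x. emeasure M (ball x \<rho>) < \<infinity>"
  shows "sigma_finite_measure M"
proof
  obtain D :: "'a set" where D: "countable D" "\<And>X. open X \<Longrightarrow> X \<noteq> {} \<Longrightarrow> \<exists>d\<in>D. d \<in> X"
    using countable_dense_setE by metis
  have "x \<in> (\<Union>d\<in>D. ball d \<rho>)" for x
    using D(2)[of "ball x \<rho>"] \<open>\<rho> > 0\<close> by (auto simp: dist_commute)
  then show "\<exists>A. countable A \<and> A \<subseteq> sets M \<and> \<Union>A = space M \<and> (\<forall>a\<in>A. emeasure M a \<noteq> \<infinity>)"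
    using D(1) fin sets_eq_imp_space_eq[OF sets]
    by (intro exI[of _ "(\<lambda>d. ball d \<rho>) ` D"]) (auto simp: sets less_top[symmetric])
qed

text \<open>The complement is the open \<rho>-neighbourhood of \<open>- U\<close>.\<close>

lemma ball_subset_borel:
  fixes U :: "'a::metric_space set"
  shows "{x. ball x \<rho> \<subseteq> U} \<in> sets borel"
proof -
  have "{x. ball x \<rho> \<subseteq> U} = - (\<Union>y\<in>-U. ball y \<rho>)"
    by (auto simp: dist_commute)
  moreover have "open (\<Union>y\<in>-U. ball y \<rho>)" by auto
  ultimately show ?thesis by (metis borel_comp borel_open)
qed

text \<open>Fubini for \<open>{(x, y). dist x y < \<rho> \<and> y \<in> U}\<close>.\<close>

lemma emeasure_ball_subset_le:
  fixes M N :: "'a::{metric_space,second_countable_topology} measure"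
  assumes sM: "sets M = sets borel" and sN: "sets N = sets borel"
    and "sigma_finite_measure M" "sigma_finite_measure N"
    and h: "\<And>x. emeasure M (ball x \<rho>) = h" and g: "\<And>x. emeasure N (ball x \<rho>) = g"
    and U: "open U"
  shows "emeasure N {x. ball x \<rho> \<subseteq> U} * h \<le> g * emeasure M U"
proof -
  interpret M: sigma_finite_measure M by fact
  interpret N: sigma_finite_measure N by fact
  interpret NM: pair_sigma_finite N M ..
  note [measurable_cong] = sM sN
  note [measurable] = ball_subset_borel borel_open[OF U]
  define X where "X = {z \<in> space (N \<Otimes>\<^sub>M M). dist (fst z) (snd z) < \<rho> \<and> snd z \<in> U}"
  have X[measurable]: "X \<in> sets (N \<Otimes>\<^sub>M M)" unfolding X_def by measurable
  have sp: "space M = UNIV" "space N = UNIV"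
    using sets_eq_imp_space_eq[OF sM] sets_eq_imp_space_eq[OF sN] by auto
  have "emeasure N {x. ball x \<rho> \<subseteq> U} * h = (\<integral>\<^sup>+x. h * indicator {x. ball x \<rho> \<subseteq> U} x \<partial>N)"
    by (subst nn_integral_cmult_indicator) (auto simp: sN ball_subset_borel mult.commute)
  also have "\<dots> \<le> (\<integral>\<^sup>+x. emeasure M (Pair x -` X) \<partial>N)"
  proof (rule nn_integral_mono)
    fix x
    show "h * indicator {x. ball x \<rho> \<subseteq> U} x \<le> emeasure M (Pair x -` X)"
    proof (cases "ball x \<rho> \<subseteq> U")
      case True
      then have "Pair x -` X = ball x \<rho>" by (auto simp: X_def space_pair_measure sp)
      then show ?thesis using True h by simp
    qed auto
  qed
  also have "\<dots> = emeasure (N \<Otimes>\<^sub>M M) X"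
    by (rule M.emeasure_pair_measure_alt[OF X, symmetric])
  also have "\<dots> = (\<integral>\<^sup>+y. emeasure N ((\<lambda>x. (x, y)) -` X) \<partial>M)"
    by (rule NM.emeasure_pair_measure_alt2[OF X])
  also have "\<dots> = (\<integral>\<^sup>+y. g * indicator U y \<partial>M)"
  proof (rule nn_integral_cong)
    fix y
    have "(\<lambda>x. (x, y)) -` X = (if y \<in> U then ball y \<rho> else {})"
      by (auto simp: X_def space_pair_measure sp dist_commute)
    then show "emeasure N ((\<lambda>x. (x, y)) -` X) = g * indicator U y"
      using g by simp
  qed
  also have "\<dots> = g * emeasure M U"
    by (subst nn_integral_cmult_indicator) (auto simp: sM borel_open[OF U])
  finally show ?thesis .
qed

text \<open>The radii \<open>\<delta> / real (Suc k)\<close> tend to 0 but never leave (0,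
  \<delta>], the range in which the masses of balls will be under control.\<close>

lemma emeasure_open_SUP_ball_subset:
  fixes N :: "'a::metric_space measure"
  assumes sets: "sets N = sets borel" and "open U" "\<delta> > 0"
  shows "emeasure N U = (SUP k. emeasure N {x. ball x (\<delta> / real (Suc k)) \<subseteq> U})"
proof -
  have "(SUP k. emeasure N {x. ball x (\<delta> / real (Suc k)) \<subseteq> U})
      = emeasure N (\<Union>k. {x. ball x (\<delta> / real (Suc k)) \<subseteq> U})"
  proof (rule SUP_emeasure_incseq)
    show "range (\<lambda>k. {x. ball x (\<delta> / real (Suc k)) \<subseteq> U}) \<subseteq> sets N"
      using ball_subset_borel sets by auto
    show "incseq (\<lambda>k. {x. ball x (\<delta> / real (Suc k)) \<subseteq> U})"
    proof (rule incseq_SucI, safe)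
      fix k x y assume *: "ball x (\<delta> / real (Suc k)) \<subseteq> U" "y \<in> ball x (\<delta> / real (Suc (Suc k)))"
      have "\<delta> / real (Suc (Suc k)) \<le> \<delta> / real (Suc k)"
        using \<open>\<delta> > 0\<close> by (intro divide_left_mono) auto
      then show "y \<in> U" using * by (auto simp: subset_iff)
    qed
  qed
  also have "(\<Union>k. {x. ball x (\<delta> / real (Suc k)) \<subseteq> U}) = U"
  proof safe
    fix x k assume "ball x (\<delta> / real (Suc k)) \<subseteq> U"
    then show "x \<in> U" using \<open>\<delta> > 0\<close> by (metis centre_in_ball divide_pos_pos of_nat_0_less_iff subsetD zero_less_Suc)
  next
    fix x assume "x \<in> U"
    then obtain e where e: "e > 0" "ball x e \<subseteq> U" using \<open>open U\<close> open_contains_ball by blast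
    obtain k where "inverse (real (Suc k)) < e / \<delta>"
      using reals_Archimedean[of "e / \<delta>"] e \<open>\<delta> > 0\<close> by auto
    then have "\<delta> / real (Suc k) < e" using \<open>\<delta> > 0\<close> by (simp add: field_simps)
    then have "ball x (\<delta> / real (Suc k)) \<subseteq> U" using e by (auto simp: subset_iff)
    then show "x \<in> (\<Union>k. {x. ball x (\<delta> / real (Suc k)) \<subseteq> U})" by auto
  qed
  finally show ?thesis by simp
qed

text \<open>Exchanging \<open>U\<close> with \<open>V\<close> and \<open>M\<close> with \<open>N\<close> gives Christensen's theorem that uniformly distributed
  measures are proportional; this one-sided form also covers the case where \<open>N\<close> vanishes. The two
  instances of \<open>emeasure_ball_subset_le\<close> carry inverse factors \<open>g \<rho> / h \<rho>\<close>, which cancel in the product.\<close>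

lemma uniformly_distributed_cross_le:
  fixes M N :: "'a::{metric_space,second_countable_topology} measure"
  assumes sM: "sets M = sets borel" and sN: "sets N = sets borel" and "\<delta> > 0"
    and h: "\<And>x \<rho>. 0 < \<rho> \<Longrightarrow> \<rho> \<le> \<delta> \<Longrightarrow> emeasure M (ball x \<rho>) = h \<rho>"
    and h_pos: "\<And>\<rho>. 0 < \<rho> \<Longrightarrow> \<rho> \<le> \<delta> \<Longrightarrow> 0 < h \<rho> \<and> h \<rho> < \<infinity>"
    and g: "\<And>x \<rho>. 0 < \<rho> \<Longrightarrow> \<rho> \<le> \<delta> \<Longrightarrow> emeasure N (ball x \<rho>) = g \<rho>"
    and g_fin: "\<And>\<rho>. 0 < \<rho> \<Longrightarrow> \<rho> \<le> \<delta> \<Longrightarrow> g \<rho> < \<infinity>"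
    and U: "open U" and V: "open V"
  shows "emeasure N U * emeasure M V \<le> emeasure M U * emeasure N V"
proof -
  define I where "I W k = {x::'a. ball x (\<delta> / real (Suc k)) \<subseteq> W}" for W k
  have sf: "sigma_finite_measure M" "sigma_finite_measure N"
    using sigma_finite_measure_balls[OF sM \<open>\<delta> > 0\<close>] sigma_finite_measure_balls[OF sN \<open>\<delta> > 0\<close>]
      h g h_pos g_fin \<open>\<delta> > 0\<close> by auto
  have diag: "emeasure N (I U k) * emeasure M (I V k) \<le> emeasure M U * emeasure N V" for k
  proof -
    define \<rho> where "\<rho> = \<delta> / real (Suc k)"
    have \<rho>: "0 < \<rho>" "\<rho> \<le> \<delta>" using \<open>\<delta> > 0\<close> by (auto simp: \<rho>_def field_simps)
    have 1: "emeasure N (I U k) * h \<rho> \<le> g \<rho> * emeasure M U"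
      unfolding I_def \<rho>_def[symmetric]
      by (rule emeasure_ball_subset_le) (use sM sN sf h g \<rho> U in auto)
    have 2: "emeasure M (I V k) * g \<rho> \<le> h \<rho> * emeasure N V"
      unfolding I_def \<rho>_def[symmetric]
      by (rule emeasure_ball_subset_le) (use sM sN sf h g \<rho> V in auto)
    show ?thesis
    \<comment> \<open>Cancellation needs a nonzero \<open>g \<rho>\<close>. If it is 0, the first
      estimate together with \<open>h \<rho> > 0\<close> already forces the \<open>N\<close> factor
      to vanish.\<close>
    proof (cases "g \<rho> = 0")
      case True
      then have "emeasure N (I U k) = 0" using 1 h_pos[OF \<rho>] by auto
      then show ?thesis by simp
    next
      case False
      have "(h \<rho> * g \<rho>) * (emeasure N (I U k) * emeasure M (I V k))
          \<le> (h \<rho> * g \<rho>) * (emeasure M U * emeasure N V)"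
        using mult_mono[OF 1 2] by (simp add: mult_ac)
      moreover have "h \<rho> * g \<rho> \<noteq> 0" "h \<rho> * g \<rho> \<noteq> \<top>"
        using False h_pos[OF \<rho>] g_fin[OF \<rho>] by (auto simp: ennreal_mult_eq_top_iff)
      ultimately show ?thesis by (simp add: ennreal_mult_le_mult_iff)
    qed
  qed
  have mono: "I W j \<subseteq> I W k" if "j \<le> k" for W j k
  proof -
    have "\<delta> / real (Suc k) \<le> \<delta> / real (Suc j)"
      using \<open>\<delta> > 0\<close> that by (intro divide_left_mono) auto
    then show ?thesis by (auto simp: I_def subset_iff)
  qed
  \<comment> \<open>The estimates cancel only at a common radius, but a product of two suprema runs
    over two independent indices; monotonicity of \<open>I\<close> passes to the larger one.\<close>
  have le: "emeasure N (I U j) * emeasure M (I V k) \<le> emeasure M U * emeasure N V" for j k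
  proof -
    have "emeasure N (I U j) * emeasure M (I V k)
        \<le> emeasure N (I U (max j k)) * emeasure M (I V (max j k))"
      by (intro mult_mono emeasure_mono mono) (auto simp: sM sN I_def ball_subset_borel)
    also note diag
    finally show ?thesis .
  qed
  have "emeasure N U * emeasure M V
      = (SUP k. SUP j. emeasure N (I U j) * emeasure M (I V k))"
    unfolding emeasure_open_SUP_ball_subset[OF sN U \<open>\<delta> > 0\<close>]
      emeasure_open_SUP_ball_subset[OF sM V \<open>\<delta> > 0\<close>] I_def
    by (simp add: SUP_mult_left_ennreal SUP_mult_right_ennreal)
  also have "\<dots> \<le> emeasure M U * emeasure N V"
    by (intro SUP_least le)
  finally show ?thesis .
qed

section \<open>Hyperbolic space\<close>

lemma minkowski_add_left: "minkowski (p + q) z = minkowski p z + minkowski q z"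
  and minkowski_add_right: "minkowski z (p + q) = minkowski z p + minkowski z q"
  and minkowski_scaleR_left: "minkowski (a *\<^sub>R p) z = a * minkowski p z"
  and minkowski_scaleR_right: "minkowski z (a *\<^sub>R p) = a * minkowski z p"
  by (simp_all add: minkowski_def algebra_simps)

lemma minkowski_self: "minkowski z z = (snd z)\<^sup>2 - (norm (fst z))\<^sup>2"
  by (simp add: minkowski_def power2_norm_eq_inner power2_eq_square[of "snd z"])

lemma minkowski_Rep_self [simp]: "minkowski (Rep_hyperbolic x) (Rep_hyperbolic x) = 1"
  and snd_Rep_pos [simp]: "snd (Rep_hyperbolic x) > 0"
  using Rep_hyperbolic[of x] by auto

lemma Rep_Abs_hyperbolic:
  "minkowski p p = 1 \<Longrightarrow> snd p > 0 \<Longrightarrow> Rep_hyperbolic (Abs_hyperbolic p) = p"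
  by (rule Abs_hyperbolic_inverse) simp

lemma Rep_hyp_origin [simp]: "Rep_hyperbolic hyp_origin = (0, 1)"
  unfolding hyp_origin_def by (rule Rep_Abs_hyperbolic) (auto simp: minkowski_def)

lemma minkowski_Rep_ge_1: "minkowski (Rep_hyperbolic x) (Rep_hyperbolic y) \<ge> 1"
  by (rule minkowski_ge_1) auto

lemma cosh_dist_hyperbolic: "cosh (dist x y) = minkowski (Rep_hyperbolic x) (Rep_hyperbolic y)"
  by (simp add: dist_hyperbolic_def hyp_dist_def cosh_arcosh_real minkowski_Rep_ge_1)

lemma dist_less_iff_minkowski:
  "r > 0 \<Longrightarrow> dist x y < r \<longleftrightarrow> minkowski (Rep_hyperbolic x) (Rep_hyperbolic y) < cosh r"
  by (simp add: cosh_dist_hyperbolic[symmetric] cosh_real_nonneg_less_iff)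

lemma dist_le_iff_minkowski:
  "r \<ge> 0 \<Longrightarrow> dist x y \<le> r \<longleftrightarrow> minkowski (Rep_hyperbolic x) (Rep_hyperbolic y) \<le> cosh r"
  by (simp add: cosh_dist_hyperbolic[symmetric] cosh_real_nonneg_le_iff)

text \<open>Inside the future light cone the spatial norm is below the time coordinate, so
  Cauchy-Schwarz keeps the spatial part of the product below the temporal part.\<close>

lemma minkowski_pos:
  assumes "minkowski z z > 0" "snd z > 0" "minkowski p p > 0" "snd p > 0"
  shows "minkowski p z > 0"
proof -
  have "norm (fst z) < snd z" "norm (fst p) < snd p"
    using assms by (auto simp: minkowski_def power2_norm_eq_inner[symmetric] power2_eq_square[symmetric]
      intro: power2_less_imp_less)
  then have "norm (fst p) * norm (fst z) < snd p * snd z"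
    by (intro mult_strict_mono') auto
  then show ?thesis
    using norm_cauchy_schwarz[of "fst p" "fst z"] by (simp add: minkowski_def)
qed

text \<open>This decides on which sheet a constructed vector lies: were it on the lower one,
  \<open>- z\<close> would be future-directed and pair positively with \<open>p\<close>.\<close>

lemma snd_pos_if_minkowski_pos:
  assumes "minkowski z z > 0" "minkowski p p > 0" "snd p > 0" "minkowski p z > 0"
  shows "snd z > 0"
proof (rule ccontr)
  assume "\<not> snd z > 0"
  moreover have "snd z \<noteq> 0"
    using assms(1) inner_ge_zero[of "fst z"] by (auto simp: minkowski_def simp del: inner_ge_zero)
  ultimately have "snd (- z) > 0" by simp
  moreover have "minkowski (- z) (- z) > 0" using assms by (simp add: minkowski_def)
  ultimately have "minkowski p (- z) > 0" using assms by (metis minkowski_pos)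
  then show False using assms by (simp add: minkowski_def)
qed

lemma cosh_real_inject: "0 \<le> a \<Longrightarrow> 0 \<le> b \<Longrightarrow> cosh a = cosh b \<Longrightarrow> a = (b::real)"
  using arcosh_cosh_real[of a] arcosh_cosh_real[of b] by simp

text \<open>The parameter \<open>t\<close> is any real, so the line extends beyond both points:
  \<open>t = - r\<close> gives a point behind \<open>x\<close>, and half the distance gives the
  midpoint.\<close>

lemma hyperbolic_geodesic:
  fixes x y :: "'n::finite hyperbolic"
  assumes "x \<noteq> y"
  shows "\<exists>z. dist x z = \<bar>t\<bar> \<and> dist z y = \<bar>dist x y - t\<bar>"
proof -
  define d p q where "d = dist x y" and "p = Rep_hyperbolic x" and "q = Rep_hyperbolic y"
  have d: "d > 0" using assms by (simp add: d_def)
  have pq: "minkowski p q = cosh d" "minkowski q p = cosh d" "minkowski p p = 1" "minkowski q q = 1" "snd p > 0"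
    by (auto simp: d_def p_def q_def cosh_dist_hyperbolic minkowski_commute)
  have s: "sinh d > 0" using d by simp
  \<comment> \<open>The unit-speed geodesic through \<open>p\<close> and \<open>q\<close>: the
    hyperbolic analogue of spherical linear interpolation.\<close>
  define u where "u = (sinh (d - t) / sinh d) *\<^sub>R p + (sinh t / sinh d) *\<^sub>R q"
  have pu: "minkowski p u = cosh t"
    using s unfolding u_def by (simp add: minkowski_add_right minkowski_scaleR_right pq field_simps sinh_diff)
  have "sinh (d - t) * cosh d + sinh t = sinh d * cosh (d - t)"
    using sinh_add[of "d - t" d] sinh_diff[of "d - t" d] sinh_add[of d "d - t"]
      sinh_diff[of d "d - t"] by (simp add: algebra_simps)
  then have qu: "minkowski q u = cosh (d - t)"
    using s unfolding u_def by (simp add: minkowski_add_right minkowski_scaleR_right pq field_simps)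
  have "minkowski u u = sinh (d - t) / sinh d * minkowski p u + sinh t / sinh d * minkowski q u"
    by (subst (1) u_def) (simp only: minkowski_add_left minkowski_scaleR_left)
  also have "\<dots> = (sinh (d - t) * cosh t + sinh t * cosh (d - t)) / sinh d"
    by (simp add: pu qu add_divide_distrib)
  also have "sinh (d - t) * cosh t + sinh t * cosh (d - t) = sinh d"
    using sinh_add[of "d - t" t] by (simp add: algebra_simps)
  finally have uu: "minkowski u u = 1" using s by simp
  have "snd u > 0"
    by (rule snd_pos_if_minkowski_pos[of u p]) (use pu uu pq in \<open>auto intro: cosh_real_pos\<close>)
  then have R: "Rep_hyperbolic (Abs_hyperbolic u) = u" using uu by (simp add: Rep_Abs_hyperbolic)
  have "cosh (dist x (Abs_hyperbolic u)) = cosh \<bar>t\<bar>"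
    using pu by (simp add: cosh_dist_hyperbolic R p_def)
  then have "dist x (Abs_hyperbolic u) = \<bar>t\<bar>"
    by (rule cosh_real_inject[rotated 2]) auto
  moreover have "cosh (dist (Abs_hyperbolic u) y) = cosh \<bar>d - t\<bar>"
    using qu by (simp add: cosh_dist_hyperbolic R q_def minkowski_commute)
  then have "dist (Abs_hyperbolic u) y = \<bar>d - t\<bar>"
    by (rule cosh_real_inject[rotated 2]) auto
  ultimately show ?thesis unfolding d_def by blast
qed

text \<open>Lets disjointness of distinct balls be read as a statement on distinct centers. The
  point at distance \<open>r\<close> behind \<open>x\<close>, as seen from \<open>y\<close>, is too
  far from \<open>y\<close>.\<close>

lemma cball_hyperbolic_inject:
  fixes x y :: "'n::finite hyperbolic"
  assumes "cball x r = cball y r" "r \<ge> 0"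
  shows "x = y"
proof (rule ccontr)
  assume "x \<noteq> y"
  then obtain z where z: "dist x z = r" "dist z y = dist x y + r"
    using hyperbolic_geodesic[of x y "- r"] assms(2) by auto
  then have "z \<in> cball y r" using assms by auto
  then show False using z \<open>x \<noteq> y\<close> by (simp add: dist_commute)
qed

text \<open>Otherwise the midpoint would lie in both open balls.\<close>

lemma disjoint_cballs_dist_ge:
  fixes x y :: "'n::finite hyperbolic"
  assumes "interior (cball x r) \<inter> interior (cball y r) = {}" "x \<noteq> y"
  shows "dist x y \<ge> 2 * r"
proof (rule ccontr)
  assume *: "\<not> ?thesis"
  obtain z where "dist x z = \<bar>dist x y / 2\<bar>" "dist z y = \<bar>dist x y - dist x y / 2\<bar>"
    using hyperbolic_geodesic[OF assms(2)] by blast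
  then have "z \<in> ball x r \<inter> ball y r" using * by (auto simp: dist_commute)
  moreover have "ball x r \<subseteq> interior (cball x r)" for x :: "'n hyperbolic"
    by (intro interior_maximal) auto
  ultimately show False using assms by blast
qed

section \<open>The metric topology in Minkowski coordinates\<close>

lemma isCont_minkowski: "isCont (\<lambda>x. minkowski p (Rep_hyperbolic x)) y"
  if "minkowski p p = 1" "snd p > 0"
proof -
  have "(\<lambda>x. minkowski p (Rep_hyperbolic x)) = (\<lambda>x. cosh (dist (Abs_hyperbolic p) x))"
    using that by (simp add: cosh_dist_hyperbolic Rep_Abs_hyperbolic)
  then show ?thesis by (auto intro!: continuous_intros)
qed

lemma continuous_on_Rep_hyperbolic:
  fixes A :: "'n::finite hyperbolic set"
  shows "continuous_on A Rep_hyperbolic"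
proof -
  have snd: "isCont (\<lambda>x. snd (Rep_hyperbolic x)) y" for y :: "'n hyperbolic"
    using isCont_minkowski[of "(0, 1)" y] by (simp add: minkowski_def)
  have inner: "isCont (\<lambda>x. v \<bullet> fst (Rep_hyperbolic x)) y" for v and y :: "'n hyperbolic"
  proof -
    \<comment> \<open>The metric controls pairings with points of the hyperboloid only, so
      \<open>v\<close> is lifted to the point \<open>(v, w)\<close> on it; the inner product with
      \<open>v\<close> is then a difference of two continuous functions.\<close>
    define w where "w = sqrt (1 + v \<bullet> v)"
    have "1 + v \<bullet> v > 0" using inner_ge_zero[of v] by linarith
    then have w: "w > 0" "w * w = 1 + v \<bullet> v" by (auto simp: w_def)
    have "isCont (\<lambda>x. w * snd (Rep_hyperbolic x) - minkowski (v, w) (Rep_hyperbolic x)) y"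
      by (intro continuous_intros isCont_minkowski snd) (use w in \<open>auto simp: minkowski_def\<close>)
    then show ?thesis by (simp add: minkowski_def)
  qed
  have "isCont Rep_hyperbolic y" for y :: "'n hyperbolic"
  proof -
    have "isCont (\<lambda>x. \<Sum>b\<in>Basis. (b \<bullet> fst (Rep_hyperbolic x)) *\<^sub>R b) y"
      by (intro continuous_intros inner)
    moreover have "(\<Sum>b\<in>Basis. (b \<bullet> z) *\<^sub>R b) = z" for z :: "real^'n"
      by (simp only: inner_commute[of _ z] euclidean_representation)
    ultimately have "isCont (\<lambda>x. fst (Rep_hyperbolic x)) y"
      by simp
    then have "isCont (\<lambda>x. (fst (Rep_hyperbolic x), snd (Rep_hyperbolic x))) y"
      using snd unfolding isCont_def by (intro tendsto_Pair)
    then show ?thesis by simp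
  qed
  then show ?thesis by (simp add: continuous_at_imp_continuous_on)
qed

lemma ball_hyperbolic_eq_vimage:
  "\<exists>V. open V \<and> ball x r = Rep_hyperbolic -` V"
proof (cases "r > 0")
  case True
  have "open {z. minkowski (Rep_hyperbolic x) z < cosh r}"
    unfolding minkowski_def by (intro open_Collect_less continuous_intros)
  moreover have "ball x r = Rep_hyperbolic -` {z. minkowski (Rep_hyperbolic x) z < cosh r}"
    by (simp only: set_eq_iff mem_ball vimage_Collect_eq mem_Collect_eq dist_less_iff_minkowski[OF True]) simp
  ultimately show ?thesis by (intro exI conjI)
next
  case False
  then have "ball x r = Rep_hyperbolic -` {}" by simp
  then show ?thesis using open_empty by (intro exI conjI)
qed

text \<open>With continuity of \<open>Rep_hyperbolic\<close> this makes the metric topology the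
  subspace topology, from which second countability and measurability of the radial projection are
  inherited.\<close>

lemma open_hyperbolic_eq_vimage:
  fixes U :: "'n::finite hyperbolic set"
  assumes "open U"
  shows "\<exists>V. open V \<and> U = Rep_hyperbolic -` V"
proof -
  have "\<forall>x\<in>U. \<exists>V. open V \<and> x \<in> Rep_hyperbolic -` V \<and> Rep_hyperbolic -` V \<subseteq> U"
  proof
    fix x assume "x \<in> U"
    then obtain e where "e > 0" "ball x e \<subseteq> U" using assms open_contains_ball by blast
    then show "\<exists>V. open V \<and> x \<in> Rep_hyperbolic -` V \<and> Rep_hyperbolic -` V \<subseteq> U"
      using ball_hyperbolic_eq_vimage[of x e] by (metis centre_in_ball)
  qed
  then obtain V where V: "\<And>x. x \<in> U \<Longrightarrow> open (V x) \<and> x \<in> Rep_hyperbolic -` V x \<and> Rep_hyperbolic -` V x \<subseteq> U"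
    by metis
  then show ?thesis by (intro exI[of _ "\<Union>x\<in>U. V x"]) auto
qed

instance hyperbolic :: (finite) second_countable_topology
proof
  obtain B :: "((real^'a) \<times> real) set set" where B: "countable B" "topological_basis B"
    using ex_countable_basis by blast
  let ?B = "(\<lambda>V. Rep_hyperbolic -` V) ` B :: 'a hyperbolic set set"
  have "topological_basis ?B"
    unfolding topological_basis_def
  proof safe
    fix V assume "V \<in> B"
    then have "open V" using B topological_basis_open by blast
    then show "open (Rep_hyperbolic -` V :: 'a hyperbolic set)"
      using continuous_on_open_vimage[OF open_UNIV] continuous_on_Rep_hyperbolic by fastforce
  next
    fix U :: "'a hyperbolic set" assume "open U"
    then obtain V where V: "open V" "U = Rep_hyperbolic -` V"
      using open_hyperbolic_eq_vimage by blast
    then obtain C where "C \<subseteq> B" "\<Union>C = V" using B unfolding topological_basis_def by blast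
    then show "\<exists>C\<subseteq>?B. \<Union>C = U" using V by (intro exI[of _ "(\<lambda>V. Rep_hyperbolic -` V) ` C"]) auto
  qed
  then have "open = generate_topology ?B" by (rule topological_basis_imp_subbasis)
  moreover have "countable ?B" using B(1) by simp
  ultimately show "\<exists>B::'a hyperbolic set set. countable B \<and> open = generate_topology B"
    by (intro exI[of _ ?B] conjI)
qed

section \<open>Boosts\<close>

definition shear_space :: "real \<Rightarrow> real^'n \<Rightarrow> (real^'n) \<times> real \<Rightarrow> (real^'n) \<times> real" where
  "shear_space a v z = (fst z + (a * snd z) *\<^sub>R v, snd z)"

definition shear_time :: "real^'n \<Rightarrow> (real^'n) \<times> real \<Rightarrow> (real^'n) \<times> real" where
  "shear_time v z = (fst z, snd z + v \<bullet> fst z)"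

text \<open>The Lorentz boost moving \<open>(0, 1)\<close> to \<open>(v, sqrt (1 + v \<bullet> v))\<close>, written as three shears so that
  preservation of Lebesgue measure reduces to translation invariance on slices.\<close>

definition boost :: "real^'n \<Rightarrow> (real^'n) \<times> real \<Rightarrow> (real^'n) \<times> real" where
  "boost v z = (let a = 1 / (1 + sqrt (1 + v \<bullet> v))
     in shear_space a v (shear_time v (shear_space a v z)))"

text \<open>The usual closed form. With w the square root and a = 1 / (1 + w), the shears collapse
  through a + a w = 1 and a |v|^2 = w - 1.\<close>

lemma boost_eq:
  "boost v z = (fst z + (snd z + (v \<bullet> fst z) / (1 + sqrt (1 + v \<bullet> v))) *\<^sub>R v,
     sqrt (1 + v \<bullet> v) * snd z + v \<bullet> fst z)"
proof -
  define w a where "w = sqrt (1 + v \<bullet> v)" and "a = 1 / (1 + w)"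
  have "0 \<le> v \<bullet> v" by simp
  then have w: "w \<ge> 1" "v \<bullet> v = w * w - 1" by (auto simp: w_def)
  have a: "a + a * w = 1" using w by (simp add: a_def field_simps)
  have av: "a * (v \<bullet> v) = w - 1"
    using w by (simp add: a_def field_simps)
  have 2: "snd z + (v \<bullet> fst z + a * snd z * (v \<bullet> v)) = w * snd z + v \<bullet> fst z"
    using arg_cong[OF av, of "\<lambda>x. snd z * x"] by (simp add: algebra_simps)
  have 1: "a * snd z + a * (w * snd z + v \<bullet> fst z) = snd z + (v \<bullet> fst z) * a"
    using arg_cong[OF a, of "\<lambda>x. snd z * x"] by (simp add: algebra_simps)
  have "boost v z = (fst z + (a * snd z) *\<^sub>R v + (a * (snd z + (v \<bullet> fst z + a * snd z * (v \<bullet> v)))) *\<^sub>R v,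
      snd z + (v \<bullet> fst z + a * snd z * (v \<bullet> v)))"
    by (simp add: boost_def Let_def shear_space_def shear_time_def w_def[symmetric] a_def[symmetric]
      inner_add_right)
  also have "\<dots> = (fst z + (snd z + (v \<bullet> fst z) * a) *\<^sub>R v, w * snd z + v \<bullet> fst z)"
    unfolding 2 1[symmetric] by (simp add: scaleR_add_left)
  finally show ?thesis by (simp add: a_def w_def)
qed

text \<open>Negating \<open>v\<close> inverts each shear and leaves the coefficient unchanged, and
  the three shears form a palindrome.\<close>

lemma boost_uminus_cancel: "boost (- v) (boost v z) = z"
  by (simp add: boost_def Let_def shear_space_def shear_time_def)

lemma boost_origin: "boost v (0, 1) = (v, sqrt (1 + v \<bullet> v))"
  by (simp add: boost_eq)

lemma minkowski_boost: "minkowski (boost v p) (boost v q) = minkowski p q"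
proof -
  define w a where "w = sqrt (1 + v \<bullet> v)" and "a = 1 / (1 + w)"
  have "0 \<le> v \<bullet> v" by simp
  then have w: "w \<ge> 1" "v \<bullet> v = w * w - 1" by (auto simp: w_def)
  have a: "a * (1 + w) = 1" using w by (simp add: a_def)
  obtain x s y t where pq: "p = (x, s)" "q = (y, t)" by (metis surj_pair)
  define X Y where "X = v \<bullet> x" and "Y = v \<bullet> y"
  have b: "boost v p = (x + (s + a * X) *\<^sub>R v, w * s + X)" "boost v q = (y + (t + a * Y) *\<^sub>R v, w * t + Y)"
    by (simp_all add: boost_eq pq a_def w_def X_def Y_def)
  have c: "x \<bullet> v = X" "v \<bullet> y = Y" by (simp_all add: X_def Y_def inner_commute)
  have "(x + (s + a * X) *\<^sub>R v) \<bullet> (y + (t + a * Y) *\<^sub>R v)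
      = x \<bullet> y + (t + a * Y) * X + (s + a * X) * Y + (s + a * X) * (t + a * Y) * (w * w - 1)"
    by (simp add: inner_add_left inner_add_right c w(2)) (simp add: algebra_simps)
  moreover have "(w * s + X) * (w * t + Y) - (x \<bullet> y + (t + a * Y) * X + (s + a * X) * Y
      + (s + a * X) * (t + a * Y) * (w * w - 1)) = s * t - x \<bullet> y"
    using a by algebra
  ultimately show ?thesis
    unfolding b unfolding minkowski_def pq by simp
qed

text \<open>The time coordinate of \<open>z\<close> is its pairing with \<open>(0, 1)\<close>, hence
  also the pairing of the boosted vector with the boosted origin, which is future-directed.\<close>

lemma snd_boost_pos_iff:
  assumes "minkowski z z > 0"
  shows "snd (boost v z) > 0 \<longleftrightarrow> snd z > 0"
proof -
  have o: "minkowski (0, 1) z = snd z" by (simp add: minkowski_def)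
  have "minkowski (v, sqrt (1 + v \<bullet> v)) (boost v z) = snd z"
    using minkowski_boost[of v "(0, 1)" z] o by (simp add: boost_origin)
  moreover have "minkowski (v, sqrt (1 + v \<bullet> v)) (v, sqrt (1 + v \<bullet> v)) = 1"
    by (simp add: minkowski_def)
  moreover have "1 + v \<bullet> v > 0" using inner_ge_zero[of v] by linarith
  moreover have "minkowski (boost v z) (boost v z) > 0" using assms by (simp add: minkowski_boost)
  ultimately show ?thesis
    using minkowski_pos[of "boost v z" "(v, sqrt (1 + v \<bullet> v))"]
      snd_pos_if_minkowski_pos[of "boost v z" "(v, sqrt (1 + v \<bullet> v))"] by fastforce
qed

definition hyp_boost :: "real^'n::finite \<Rightarrow> 'n hyperbolic \<Rightarrow> 'n hyperbolic" where
  "hyp_boost v x = Abs_hyperbolic (boost v (Rep_hyperbolic x))"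

lemma Rep_hyp_boost: "Rep_hyperbolic (hyp_boost v x) = boost v (Rep_hyperbolic x)"
  unfolding hyp_boost_def
  by (rule Rep_Abs_hyperbolic) (simp_all add: minkowski_boost snd_boost_pos_iff)

lemma hyp_boost_uminus_cancel: "hyp_boost (- v) (hyp_boost v x) = x"
  by (metis Rep_hyp_boost Rep_hyperbolic_inject boost_uminus_cancel)

lemma hyp_boost_isometry: "hyp_boost v \<in> hyp_isometries"
proof -
  have "bij (hyp_boost v)"
    by (rule o_bij[of "hyp_boost (- v)"])
      (use hyp_boost_uminus_cancel[of v] hyp_boost_uminus_cancel[of "- v"] in auto)
  then show ?thesis
    by (simp add: hyp_isometries_def dist_hyperbolic_def hyp_dist_def Rep_hyp_boost minkowski_boost)
qed

lemma boost_fst_Rep: "boost (fst (Rep_hyperbolic p)) (0, 1) = Rep_hyperbolic p"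
proof -
  have "snd (Rep_hyperbolic p) = sqrt (1 + fst (Rep_hyperbolic p) \<bullet> fst (Rep_hyperbolic p))"
    using minkowski_Rep_self[of p] snd_Rep_pos[of p]
    by (intro real_sqrt_unique[symmetric] less_imp_le) (auto simp: minkowski_def power2_eq_square)
  then show ?thesis by (simp add: boost_origin prod_eq_iff)
qed

lemma hyp_boost_origin: "hyp_boost (fst (Rep_hyperbolic p)) hyp_origin = p"
  by (simp add: Rep_hyperbolic_inject[symmetric] Rep_hyp_boost boost_fst_Rep)

section \<open>Boosts preserve Lebesgue measure\<close>

lemma emeasure_lborel_translate:
  fixes X :: "'a::euclidean_space set"
  assumes "X \<in> sets borel"
  shows "emeasure lborel ((\<lambda>x. x + c) -` X) = emeasure lborel X"
proof -
  have "emeasure lborel X = emeasure (distr lborel borel ((+) c)) X"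
    by (simp add: lborel_distr_plus)
  also have "\<dots> = emeasure lborel ((\<lambda>x. x + c) -` X)"
    using assms by (subst emeasure_distr) (auto simp: add.commute[of c, abs_def])
  finally show ?thesis by simp
qed

lemma emeasure_lborel_slices:
  fixes X :: "('a::euclidean_space \<times> 'b::euclidean_space) set"
  assumes "X \<in> sets borel"
  shows "emeasure lborel X = (\<integral>\<^sup>+x. emeasure lborel (Pair x -` X) \<partial>lborel)"
    and "emeasure lborel X = (\<integral>\<^sup>+y. emeasure lborel ((\<lambda>x. (x, y)) -` X) \<partial>lborel)"
  using lborel.emeasure_pair_measure_alt[of X lborel] lborel_pair.emeasure_pair_measure_alt2[of X] assms
  unfolding lborel_prod by simp_all

lemma vimage_shear_space_borel:
  fixes X :: "((real^'n) \<times> real) set"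
  assumes "X \<in> sets borel"
  shows "shear_space a v -` X \<in> sets borel"
  by (rule measurable_sets_borel[OF _ assms])
    (simp add: shear_space_def[abs_def] borel_measurable_continuous_onI continuous_intros)

lemma vimage_shear_time_borel:
  fixes X :: "((real^'n) \<times> real) set"
  assumes "X \<in> sets borel"
  shows "shear_time v -` X \<in> sets borel"
  by (rule measurable_sets_borel[OF _ assms])
    (simp add: shear_time_def[abs_def] borel_measurable_continuous_onI continuous_intros)

lemma emeasure_shear_space:
  fixes X :: "((real^'n) \<times> real) set"
  assumes X: "X \<in> sets borel"
  shows "emeasure lborel (shear_space a v -` X) = emeasure lborel X"
proof -
  have meas: "shear_space a v -` X \<in> sets borel"
    by (rule vimage_shear_space_borel[OF X])
  have fib: "(\<lambda>x. (x, t)) -` X \<in> sets borel" for t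
    by (rule measurable_sets_borel[OF _ X]) (intro borel_measurable_continuous_onI continuous_intros)
  have "emeasure lborel (shear_space a v -` X)
      = (\<integral>\<^sup>+t. emeasure lborel ((\<lambda>x. (x, t)) -` (shear_space a v -` X)) \<partial>lborel)"
    by (rule emeasure_lborel_slices(2)[OF meas])
  also have "\<dots> = (\<integral>\<^sup>+t. emeasure lborel ((\<lambda>x. x + (a * t) *\<^sub>R v) -` ((\<lambda>x. (x, t)) -` X)) \<partial>lborel)"
    by (simp add: shear_space_def vimage_def)
  also have "\<dots> = (\<integral>\<^sup>+t. emeasure lborel ((\<lambda>x. (x, t)) -` X) \<partial>lborel)"
    by (simp only: emeasure_lborel_translate[OF fib])
  also have "\<dots> = emeasure lborel X"
    by (rule emeasure_lborel_slices(2)[OF X, symmetric])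
  finally show ?thesis .
qed

lemma emeasure_shear_time:
  fixes X :: "((real^'n) \<times> real) set"
  assumes X: "X \<in> sets borel"
  shows "emeasure lborel (shear_time v -` X) = emeasure lborel X"
proof -
  have meas: "shear_time v -` X \<in> sets borel"
    by (rule vimage_shear_time_borel[OF X])
  have fib: "Pair x -` X \<in> sets borel" for x
    by (rule measurable_sets_borel[OF _ X]) (intro borel_measurable_continuous_onI continuous_intros)
  have "emeasure lborel (shear_time v -` X)
      = (\<integral>\<^sup>+x. emeasure lborel (Pair x -` (shear_time v -` X)) \<partial>lborel)"
    by (rule emeasure_lborel_slices(1)[OF meas])
  also have "\<dots> = (\<integral>\<^sup>+x. emeasure lborel ((\<lambda>t. t + v \<bullet> x) -` (Pair x -` X)) \<partial>lborel)"
    by (simp add: shear_time_def vimage_def)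
  also have "\<dots> = (\<integral>\<^sup>+x. emeasure lborel (Pair x -` X) \<partial>lborel)"
    by (simp only: emeasure_lborel_translate[OF fib])
  also have "\<dots> = emeasure lborel X"
    by (rule emeasure_lborel_slices(1)[OF X, symmetric])
  finally show ?thesis .
qed

lemma emeasure_boost:
  fixes X :: "((real^'n) \<times> real) set"
  assumes X: "X \<in> sets borel"
  shows "emeasure lborel (boost v -` X) = emeasure lborel X"
proof -
  define a where "a = 1 / (1 + sqrt (1 + v \<bullet> v))"
  have eq: "boost v -` X = shear_space a v -` shear_time v -` shear_space a v -` X"
    by (auto simp: boost_def a_def Let_def)
  show ?thesis
    unfolding eq using X
    by (simp add: emeasure_shear_space emeasure_shear_time vimage_shear_space_borel vimage_shear_time_borel)
qed

section \<open>Hyperbolic volume\<close>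

text \<open>The union of the segments from 0 to the points of the upper sheet, without 0
  itself.\<close>

definition future_cone :: "((real^'n) \<times> real) set" where
  "future_cone = {z. 0 < minkowski z z \<and> minkowski z z \<le> 1 \<and> snd z > 0}"

definition radial_proj :: "(real^'n) \<times> real \<Rightarrow> 'n::finite hyperbolic" where
  "radial_proj z = Abs_hyperbolic ((1 / sqrt (minkowski z z)) *\<^sub>R z)"

text \<open>Up to the factor \<open>n + 1\<close>, this is the Riemannian volume: the Lebesgue measure of the cone over a
  set. Its invariance is immediate from the linearity of the boosts.\<close>

definition hyp_volume :: "'n::finite hyperbolic measure" where
  "hyp_volume = distr (restrict_space lborel future_cone) borel radial_proj"

lemma sets_hyp_volume [simp]: "sets hyp_volume = sets borel"
  by (simp add: hyp_volume_def)

lemma continuous_on_minkowski [continuous_intros]: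
  "continuous_on A f \<Longrightarrow> continuous_on A g \<Longrightarrow> continuous_on A (\<lambda>x. minkowski (f x) (g x))"
  unfolding minkowski_def by (intro continuous_intros)

lemma future_cone_borel [measurable]: "(future_cone :: ((real^'n) \<times> real) set) \<in> sets borel"
proof -
  have "open {z::(real^'n) \<times> real. 0 < minkowski z z}" "open {z::(real^'n) \<times> real. 0 < snd z}"
    by (intro open_Collect_less continuous_intros)+
  moreover have "closed {z::(real^'n) \<times> real. minkowski z z \<le> 1}"
    by (intro closed_Collect_le continuous_intros)
  ultimately have "{z::(real^'n) \<times> real. 0 < minkowski z z} \<inter> {z. minkowski z z \<le> 1} \<inter> {z. 0 < snd z}
      \<in> sets borel"
    by (intro sets.Int borel_open borel_closed)
  then show ?thesis by (simp add: future_cone_def Int_def conj_assoc)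
qed

lemma Rep_radial_proj:
  assumes "z \<in> future_cone"
  shows "Rep_hyperbolic (radial_proj z) = (1 / sqrt (minkowski z z)) *\<^sub>R z"
  using assms unfolding radial_proj_def
  by (intro Rep_Abs_hyperbolic)
    (auto simp: future_cone_def minkowski_scaleR_left minkowski_scaleR_right power2_eq_square[symmetric]
       real_sqrt_mult[symmetric] divide_simps)

lemma measurable_radial_proj:
  "(radial_proj :: (real^'n) \<times> real \<Rightarrow> 'n::finite hyperbolic)
    \<in> measurable (restrict_space borel future_cone) borel"
proof (rule borel_measurableI)
  fix U :: "'n hyperbolic set" assume "open U"
  then obtain V where V: "open V" "U = Rep_hyperbolic -` V"
    using open_hyperbolic_eq_vimage by blast
  have cont: "continuous_on future_cone (\<lambda>z::(real^'n) \<times> real. (1 / sqrt (minkowski z z)) *\<^sub>R z)"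
    by (intro continuous_intros) (auto simp: future_cone_def)
  have "radial_proj -` U \<inter> space (restrict_space borel future_cone)
      = (\<lambda>z. (1 / sqrt (minkowski z z)) *\<^sub>R z) -` V \<inter> space (restrict_space borel future_cone)"
    by (intro set_eqI) (simp add: V(2) space_restrict_space Rep_radial_proj cong: rev_conj_cong)
  also have "\<dots> \<in> sets (restrict_space borel future_cone)"
    using V(1) by (intro measurable_sets[OF borel_measurable_continuous_on_restrict[OF cont]]) auto
  finally show "radial_proj -` U \<inter> space (restrict_space borel future_cone)
    \<in> sets (restrict_space borel future_cone)" .
qed

lemma emeasure_hyp_volume:
  assumes "A \<in> sets borel"
  shows "radial_proj -` A \<inter> future_cone \<in> sets borel"
    and "emeasure hyp_volume A = emeasure lborel (radial_proj -` A \<inter> future_cone)"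
proof -
  have m: "(radial_proj :: _ \<Rightarrow> 'a hyperbolic) \<in> measurable (restrict_space lborel future_cone) borel"
    using measurable_radial_proj
    by (subst measurable_cong_sets[OF sets_restrict_space_cong[OF sets_lborel] refl])
  then have "radial_proj -` A \<inter> space (restrict_space lborel future_cone)
      \<in> sets (restrict_space lborel future_cone)"
    by (rule measurable_sets) fact
  then show 1: "radial_proj -` A \<inter> future_cone \<in> sets borel"
    by (simp add: space_restrict_space sets_restrict_space_iff)
  show "emeasure hyp_volume A = emeasure lborel (radial_proj -` A \<inter> future_cone)"
    unfolding hyp_volume_def
    by (subst emeasure_distr[OF m assms], subst emeasure_restrict_space)
      (auto simp: space_restrict_space)
qed

lemma minkowski_Rep_radial_proj:
  "z \<in> future_cone \<Longrightarrow> minkowski p (Rep_hyperbolic (radial_proj z)) = minkowski p z / sqrt (minkowski z z)"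
  by (simp add: Rep_radial_proj minkowski_scaleR_right)

lemma radial_proj_ball:
  assumes "r > 0"
  shows "radial_proj -` ball p r \<inter> future_cone
    = {z \<in> future_cone. minkowski (Rep_hyperbolic p) z < cosh r * sqrt (minkowski z z)}"
proof -
  have "dist p (radial_proj z) < r \<longleftrightarrow> minkowski (Rep_hyperbolic p) z < cosh r * sqrt (minkowski z z)"
    if "z \<in> future_cone" for z
    using that by (simp add: dist_less_iff_minkowski[OF assms] minkowski_Rep_radial_proj
      pos_divide_less_eq future_cone_def)
  then show ?thesis by auto
qed

lemma radial_proj_cball:
  assumes "r \<ge> 0"
  shows "radial_proj -` cball p r \<inter> future_cone
    = {z \<in> future_cone. minkowski (Rep_hyperbolic p) z \<le> cosh r * sqrt (minkowski z z)}"
proof -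
  have "dist p (radial_proj z) \<le> r \<longleftrightarrow> minkowski (Rep_hyperbolic p) z \<le> cosh r * sqrt (minkowski z z)"
    if "z \<in> future_cone" for z
    using that by (simp add: dist_le_iff_minkowski[OF assms] minkowski_Rep_radial_proj
      pos_divide_le_eq future_cone_def)
  then show ?thesis by auto
qed

lemma hyp_volume_ball_eq:
  fixes p :: "'n::finite hyperbolic"
  shows "emeasure hyp_volume (ball p r) = emeasure hyp_volume (ball (hyp_origin :: 'n hyperbolic) r)"
proof (cases "r > 0")
  case True
  define v where "v = fst (Rep_hyperbolic p)"
  have "minkowski (Rep_hyperbolic p) (boost v z) = minkowski (0, 1) z" for z
    using minkowski_boost[of v "(0, 1)" z] by (simp add: v_def boost_fst_Rep)
  then have eq: "boost v -` (radial_proj -` ball p r \<inter> future_cone) = radial_proj -` ball hyp_origin r \<inter> future_cone"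
    unfolding radial_proj_ball[OF True]
    by (simp add: set_eq_iff future_cone_def minkowski_boost snd_boost_pos_iff cong: conj_cong)
  have "emeasure lborel (radial_proj -` ball (hyp_origin :: 'n hyperbolic) r \<inter> future_cone)
      = emeasure lborel (radial_proj -` ball p r \<inter> future_cone)"
    using emeasure_boost[OF emeasure_hyp_volume(1)[OF borel_open[OF open_ball]], of v p r]
    unfolding eq .
  then show ?thesis
    by (simp add: emeasure_hyp_volume(2)[OF borel_open[OF open_ball]])
qed (simp add: ball_empty)

lemma norm_less_snd_of_future_cone: "z \<in> future_cone \<Longrightarrow> norm (fst z) < snd z"
  by (cases z, rule power2_less_imp_less) (auto simp: future_cone_def minkowski_self)

lemma hyp_volume_ball_finite:
  "emeasure hyp_volume (ball (hyp_origin :: 'n::finite hyperbolic) r) < \<infinity>"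
proof (cases "r > 0")
  case True
  have "z \<in> cball 0 (cosh r) \<times> cball 0 (cosh r)" if "z \<in> radial_proj -` ball hyp_origin r \<inter> future_cone"
    for z :: "(real^'n) \<times> real"
  proof -
    have z: "z \<in> future_cone" "snd z < cosh r * sqrt (minkowski z z)"
      using that unfolding radial_proj_ball[OF True] by (auto simp: minkowski_def)
    have "sqrt (minkowski z z) \<le> 1" using z by (auto simp: future_cone_def)
    then have "cosh r * sqrt (minkowski z z) \<le> cosh r * 1"
      by (intro mult_left_mono) auto
    then have "snd z \<le> cosh r" using z(2) by linarith
    then show ?thesis using norm_less_snd_of_future_cone[OF z(1)] norm_ge_zero[of "fst z"]
      by (auto simp: mem_Times_iff simp del: norm_ge_zero)
  qed
  then have "bounded (radial_proj -` ball hyp_origin r \<inter> future_cone :: ((real^'n) \<times> real) set)"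
    by (intro bounded_subset[OF bounded_Times[OF bounded_cball bounded_cball]] subsetI)
  then show ?thesis
    unfolding emeasure_hyp_volume(2)[OF borel_open[OF open_ball]] by (rule emeasure_bounded_finite)
qed (simp add: ball_empty)

lemma hyp_volume_ball_pos:
  assumes "r > 0"
  shows "emeasure hyp_volume (ball (hyp_origin :: 'n::finite hyperbolic) r) > 0"
proof -
  define V :: "((real^'n) \<times> real) set" where
    "V = {z. 0 < minkowski z z} \<inter> {z. minkowski z z < 1} \<inter> {z. 0 < snd z}
       \<inter> {z. snd z < cosh r * sqrt (minkowski z z)}"
  have "open V" unfolding V_def
    by (intro open_Int open_Collect_less continuous_intros)
  \<comment> \<open>Half of the vector \<open>(0, 1)\<close>: it projects to the center of the ball,
    and its Minkowski square 1/4 satisfies the bounds strictly.\<close>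
  moreover have "(0, 1 / 2) \<in> V"
    using cosh_real_nonneg_less_iff[of 0 r] assms by (simp add: V_def minkowski_def real_sqrt_mult real_sqrt_divide)
  ultimately have "\<not> negligible V" using open_not_negligible by blast
  then have "emeasure lborel V \<noteq> 0"
    using \<open>open V\<close> by (simp add: negligible_iff_null_sets null_sets_def emeasure_completion)
  moreover have "V \<subseteq> radial_proj -` ball hyp_origin r \<inter> future_cone"
    unfolding radial_proj_ball[OF assms] by (auto simp: V_def future_cone_def) (simp_all add: minkowski_def)
  then have "emeasure lborel V \<le> emeasure hyp_volume (ball (hyp_origin :: 'n hyperbolic) r)"
    unfolding emeasure_hyp_volume(2)[OF borel_open[OF open_ball]]
    by (intro emeasure_mono) (simp_all add: emeasure_hyp_volume)
  ultimately show ?thesis by (metis le_zero_eq not_gr_zero)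
qed

text \<open>With S = sinh r, the two brackets are the slice lengths above y in the small cone and
  above c y in the large one. Rationalizing S a - y b gives the numerator S^2 - y^2 whatever c is,
  and the denominator S a + y b grows at most by the factor c, because sqrt (1 + (c t)^2) <= c sqrt
  (1 + t^2).\<close>

lemma slice_inequality:
  fixes c y S :: real
  assumes "c \<ge> 1" "0 \<le> y" "y \<le> S" "S > 0"
  shows "sqrt (1 + y\<^sup>2) - y * sqrt (1 + S\<^sup>2) / S
     \<le> c * (sqrt (1 + (c * y)\<^sup>2) - c * y * sqrt (1 + (c * S)\<^sup>2) / (c * S))"
proof -
  define a b a0 b0 where "a = sqrt (1 + (c * y)\<^sup>2)" and "b = sqrt (1 + (c * S)\<^sup>2)"
    and "a0 = sqrt (1 + y\<^sup>2)" and "b0 = sqrt (1 + S\<^sup>2)"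
  have sq: "a\<^sup>2 = 1 + (c * y)\<^sup>2" "b\<^sup>2 = 1 + (c * S)\<^sup>2" "a0\<^sup>2 = 1 + y\<^sup>2" "b0\<^sup>2 = 1 + S\<^sup>2"
    by (simp_all add: a_def b_def a0_def b0_def)
  have pos: "a > 0" "b > 0" "a0 > 0" "b0 > 0"
    by (simp_all add: a_def b_def a0_def b0_def add_pos_nonneg)
  have c2: "1 \<le> c\<^sup>2" using assms by simp
  have "a \<le> c * a0"
    by (rule power2_le_imp_le) (use assms pos c2 in \<open>auto simp: power_mult_distrib sq algebra_simps\<close>)
  moreover have "b \<le> c * b0"
    by (rule power2_le_imp_le) (use assms pos c2 in \<open>auto simp: power_mult_distrib sq algebra_simps\<close>)
  ultimately have "S * a \<le> S * (c * a0)" "y * b \<le> y * (c * b0)"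
    using assms by (auto intro!: mult_left_mono)
  then have den: "S * a + y * b \<le> c * (S * a0 + y * b0)"
    by (simp only: distrib_left mult.left_commute[of c] add_mono)
  have D: "S * a + y * b > 0" "S * a0 + y * b0 > 0"
    using assms pos by (auto intro: add_pos_nonneg)
  have "(S * a - y * b) * (S * a + y * b) = S\<^sup>2 * a\<^sup>2 - y\<^sup>2 * b\<^sup>2"
    by (simp add: algebra_simps power2_eq_square)
  also have "\<dots> = S\<^sup>2 - y\<^sup>2" unfolding sq by (simp add: algebra_simps power2_eq_square)
  finally have 1: "S * a - y * b = (S\<^sup>2 - y\<^sup>2) / (S * a + y * b)"
    using D by (simp add: field_simps)
  have "(S * a0 - y * b0) * (S * a0 + y * b0) = S\<^sup>2 * a0\<^sup>2 - y\<^sup>2 * b0\<^sup>2"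
    by (simp add: algebra_simps power2_eq_square)
  also have "\<dots> = S\<^sup>2 - y\<^sup>2" unfolding sq by (simp add: algebra_simps power2_eq_square)
  finally have 2: "S * a0 - y * b0 = (S\<^sup>2 - y\<^sup>2) / (S * a0 + y * b0)"
    using D by (simp add: field_simps)
  have "S\<^sup>2 - y\<^sup>2 \<ge> 0" using assms by (simp add: power_mono)
  then have "(S\<^sup>2 - y\<^sup>2) / (S * a0 + y * b0) \<le> c * ((S\<^sup>2 - y\<^sup>2) / (S * a + y * b))"
    using den D mult_left_mono[OF den, of "S\<^sup>2 - y\<^sup>2"] by (simp add: divide_simps mult_ac)
  then have "S * a0 - y * b0 \<le> c * (S * a - y * b)" by (simp only: 1 2)
  then have "(S * a0 - y * b0) / S \<le> c * (S * a - y * b) / S"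
    using assms by (intro divide_right_mono) auto
  moreover have "c * y * b / (c * S) = y * b / S" using assms by simp
  ultimately show ?thesis
    using assms unfolding a_def[symmetric] b_def[symmetric] a0_def[symmetric] b0_def[symmetric]
    by (simp add: field_simps)
qed

text \<open>The integrand is the length of the slice of the cone over the ball above the point \<open>y\<close>;
  it is negative, hence cut off to 0 by \<open>ennreal\<close>, exactly for \<open>norm y > sinh r\<close>.\<close>

lemma hyp_volume_cball_le:
  assumes "r > 0"
  shows "emeasure hyp_volume (cball (hyp_origin :: 'n::finite hyperbolic) r)
    \<le> (\<integral>\<^sup>+y. ennreal (sqrt (1 + (norm y)\<^sup>2) - norm y * cosh r / sinh r) \<partial>(lborel :: (real^'n) measure))"
proof -
  let ?X = "radial_proj -` cball (hyp_origin :: 'n hyperbolic) r \<inter> future_cone"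
  have S: "sinh r > 0" using assms by simp
  have "emeasure hyp_volume (cball (hyp_origin :: 'n hyperbolic) r)
      = (\<integral>\<^sup>+y. emeasure lborel (Pair y -` ?X) \<partial>(lborel :: (real^'n) measure))"
    by (simp add: emeasure_hyp_volume emeasure_lborel_slices(1))
  also have "\<dots> \<le> (\<integral>\<^sup>+y. ennreal (sqrt (1 + (norm y)\<^sup>2) - norm y * cosh r / sinh r) \<partial>(lborel :: (real^'n) measure))"
  proof (rule nn_integral_mono)
    fix y :: "real^'n"
    \<comment> \<open>A slice runs from the wall of the cone over the ball, where norm y = t tanh r,
      up to the hyperboloid, where t^2 = 1 + (norm y)^2.\<close>
    have "Pair y -` ?X \<subseteq> {norm y * cosh r / sinh r .. sqrt (1 + (norm y)\<^sup>2)}"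
    proof
      fix t assume "t \<in> Pair y -` ?X"
      then have t: "0 < t\<^sup>2 - (norm y)\<^sup>2" "t\<^sup>2 - (norm y)\<^sup>2 \<le> 1" "t > 0" "t \<le> cosh r * sqrt (t\<^sup>2 - (norm y)\<^sup>2)"
        unfolding vimage_Int radial_proj_cball[OF less_imp_le[OF assms]]
        by (auto simp: future_cone_def minkowski_self minkowski_def[of "(0, 1)"])
      have "t\<^sup>2 \<le> (cosh r * sqrt (t\<^sup>2 - (norm y)\<^sup>2))\<^sup>2"
        using t by (intro power_mono) auto
      then have "(norm y * cosh r)\<^sup>2 \<le> (sinh r * t)\<^sup>2"
        unfolding power_mult_distrib real_sqrt_pow2[OF less_imp_le[OF t(1)]] cosh_square_eq
        by (simp add: algebra_simps)
      then have "norm y * cosh r \<le> sinh r * t"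
        by (rule power2_le_imp_le) (use S t in auto)
      then have "norm y * cosh r / sinh r \<le> t" using S by (simp add: field_simps)
      moreover have "t \<le> sqrt (1 + (norm y)\<^sup>2)" using t by (intro real_le_rsqrt) auto
      ultimately show "t \<in> {norm y * cosh r / sinh r .. sqrt (1 + (norm y)\<^sup>2)}" by simp
    qed
    then have "emeasure lborel (Pair y -` ?X)
        \<le> emeasure lborel {norm y * cosh r / sinh r .. sqrt (1 + (norm y)\<^sup>2)}"
      by (intro emeasure_mono) auto
    also have "\<dots> \<le> ennreal (sqrt (1 + (norm y)\<^sup>2) - norm y * cosh r / sinh r)"
      by (cases "norm y * cosh r / sinh r \<le> sqrt (1 + (norm y)\<^sup>2)") auto
    finally show "emeasure lborel (Pair y -` ?X) \<le> \<dots>" .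
  qed
  finally show ?thesis .
qed

lemma hyp_volume_ball_ge:
  assumes "r > 0"
  shows "(\<integral>\<^sup>+y. ennreal (sqrt (1 + (norm y)\<^sup>2) - norm y * cosh r / sinh r) \<partial>(lborel :: (real^'n) measure))
    \<le> emeasure hyp_volume (ball (hyp_origin :: 'n::finite hyperbolic) r)"
proof -
  let ?X = "radial_proj -` ball (hyp_origin :: 'n hyperbolic) r \<inter> future_cone"
  have S: "sinh r > 0" using assms by simp
  have X: "?X \<in> sets borel" by (simp add: emeasure_hyp_volume)
  have "(\<integral>\<^sup>+y. ennreal (sqrt (1 + (norm y)\<^sup>2) - norm y * cosh r / sinh r) \<partial>(lborel :: (real^'n) measure))
      \<le> (\<integral>\<^sup>+y. emeasure lborel (Pair y -` ?X) \<partial>(lborel :: (real^'n) measure))"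
  proof (rule nn_integral_mono)
    fix y :: "real^'n"
    have "{norm y * cosh r / sinh r <..< sqrt (1 + (norm y)\<^sup>2)} \<subseteq> Pair y -` ?X"
    proof
      fix t assume t: "t \<in> {norm y * cosh r / sinh r <..< sqrt (1 + (norm y)\<^sup>2)}"
      have "0 \<le> norm y * cosh r / sinh r" using S by simp
      then have "t > 0" using t by (metis greaterThanLessThan_iff le_less_trans)
      have "norm y * cosh r < sinh r * t" using t S by (simp add: field_simps)
      then have "(norm y * cosh r)\<^sup>2 < (sinh r * t)\<^sup>2" by (intro power_strict_mono) auto
      then have less: "t\<^sup>2 < (cosh r)\<^sup>2 * (t\<^sup>2 - (norm y)\<^sup>2)"
        by (simp add: power_mult_distrib cosh_square_eq algebra_simps)
      then have pos: "0 < t\<^sup>2 - (norm y)\<^sup>2"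
        by (smt (verit) zero_le_power2 mult_nonneg_nonpos)
      have "t\<^sup>2 < (cosh r * sqrt (t\<^sup>2 - (norm y)\<^sup>2))\<^sup>2"
        using less pos by (simp add: power_mult_distrib)
      then have "t < cosh r * sqrt (t\<^sup>2 - (norm y)\<^sup>2)"
        by (rule power2_less_imp_less) (use pos in auto)
      moreover have "t\<^sup>2 \<le> 1 + (norm y)\<^sup>2"
        using t \<open>t > 0\<close> by (intro sqrt_ge_absD) auto
      ultimately show "t \<in> Pair y -` ?X"
        unfolding vimage_Int radial_proj_ball[OF assms] using pos \<open>t > 0\<close>
        by (auto simp: future_cone_def minkowski_self minkowski_def[of "(0, 1)"])
    qed
    moreover have "Pair y -` ?X \<in> sets borel"
      by (rule measurable_sets_borel[OF _ X]) (intro borel_measurable_continuous_onI continuous_intros)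
    ultimately have "emeasure lborel {norm y * cosh r / sinh r <..< sqrt (1 + (norm y)\<^sup>2)}
        \<le> emeasure lborel (Pair y -` ?X)"
      by (intro emeasure_mono) auto
    moreover have "ennreal (sqrt (1 + (norm y)\<^sup>2) - norm y * cosh r / sinh r)
        \<le> emeasure lborel {norm y * cosh r / sinh r <..< sqrt (1 + (norm y)\<^sup>2)}"
      by (cases "norm y * cosh r / sinh r \<le> sqrt (1 + (norm y)\<^sup>2)") (auto simp: ennreal_neg)
    ultimately show "ennreal (sqrt (1 + (norm y)\<^sup>2) - norm y * cosh r / sinh r)
        \<le> emeasure lborel (Pair y -` ?X)" by order
  qed
  also have "\<dots> = emeasure hyp_volume (ball (hyp_origin :: 'n hyperbolic) r)"
    by (simp add: emeasure_hyp_volume emeasure_lborel_slices(1))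
  finally show ?thesis .
qed

text \<open>Substituting c y for y, with c = 1/s, matches the spatial shadows of the two cones. The
  Jacobian c^n against the factor c lost in slice length leaves c^(n-1).\<close>

lemma hyp_volume_ball_ratio:
  fixes r R s :: real
  assumes "r > 0" "R > 0" "0 < s" "s \<le> 1" and R: "sinh R = sinh r / s"
  shows "emeasure hyp_volume (cball (hyp_origin :: 'n::finite hyperbolic) r)
    \<le> ennreal (s ^ (CARD('n) - 1)) * emeasure hyp_volume (ball (hyp_origin :: 'n hyperbolic) R)"
proof -
  define c S n where "c = 1 / s" and "S = sinh r" and "n = CARD('n)"
  have c: "c \<ge> 1" and S: "S > 0" and n: "n > 0" using assms by (auto simp: c_def S_def n_def)
  have R': "sinh R = c * S" by (simp add: R c_def S_def)
  have ch: "cosh r = sqrt (1 + S\<^sup>2)" "cosh R = sqrt (1 + (c * S)\<^sup>2)"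
    unfolding S_def R'[unfolded S_def, symmetric]
    using real_sqrt_unique[of "cosh r" "1 + (sinh r)\<^sup>2"] real_sqrt_unique[of "cosh R" "1 + (sinh R)\<^sup>2"]
    by (simp_all add: cosh_square_eq)
  define F where "F = (\<lambda>y::real^'n. ennreal (sqrt (1 + (norm y)\<^sup>2) - norm y * cosh R / sinh R))"
  define f where "f = (\<lambda>y::real^'n. ennreal (sqrt (1 + (norm y)\<^sup>2) - norm y * cosh r / sinh r))"
  have "f \<in> borel_measurable borel" "F \<in> borel_measurable borel"
    unfolding f_def F_def by measurable
  note [measurable] = this
  have pt: "ennreal (c ^ (n - 1)) * f y \<le> ennreal (c ^ n) * F (c *\<^sub>R y)" for y
  proof (cases "norm y \<le> S")
    case True
    have "sqrt (1 + (norm y)\<^sup>2) - norm y * cosh r / sinh r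
      \<le> c * (sqrt (1 + (c * norm y)\<^sup>2) - c * norm y * cosh R / sinh R)"
      unfolding R' ch unfolding S_def[symmetric] using c S True by (intro slice_inequality) auto
    then have "c ^ (n - 1) * (sqrt (1 + (norm y)\<^sup>2) - norm y * cosh r / sinh r)
      \<le> c ^ (n - 1) * (c * (sqrt (1 + (c * norm y)\<^sup>2) - c * norm y * cosh R / sinh R))"
      using c by (intro mult_left_mono) auto
    also have "\<dots> = c ^ n * (sqrt (1 + (c * norm y)\<^sup>2) - c * norm y * cosh R / sinh R)"
      using n by (cases n) auto
    finally show ?thesis
      using c by (simp add: f_def F_def ennreal_mult'[symmetric] ennreal_leI)
  next
    \<comment> \<open>Outside the shadow of the small cone, where \<open>slice_inequality\<close>
      does not apply, the left integrand is cut off to 0.\<close>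
    case False
    have "(sqrt (1 + (norm y)\<^sup>2) * S)\<^sup>2 \<le> (norm y * sqrt (1 + S\<^sup>2))\<^sup>2"
      using False S power_mono[of S "norm y" 2] by (simp add: power_mult_distrib algebra_simps)
    then have "sqrt (1 + (norm y)\<^sup>2) * S \<le> norm y * sqrt (1 + S\<^sup>2)"
      by (rule power2_le_imp_le) simp
    then have "f y = 0"
      unfolding f_def ch S_def[symmetric] using S by (intro ennreal_neg) (simp add: field_simps)
    then show ?thesis by simp
  qed
  have "ennreal (c ^ (n - 1)) * emeasure hyp_volume (cball (hyp_origin :: 'n hyperbolic) r)
      \<le> ennreal (c ^ (n - 1)) * (\<integral>\<^sup>+y. f y \<partial>lborel)"
    unfolding f_def by (intro mult_left_mono hyp_volume_cball_le assms) auto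
  also have "\<dots> = (\<integral>\<^sup>+y. ennreal (c ^ (n - 1)) * f y \<partial>lborel)"
    by (rule nn_integral_cmult[symmetric]) simp
  also have "\<dots> \<le> (\<integral>\<^sup>+y. ennreal (c ^ n) * F (c *\<^sub>R y) \<partial>lborel)"
    by (intro nn_integral_mono pt)
  also have "\<dots> = (\<integral>\<^sup>+y. F y \<partial>lborel)"
    using c by (subst (2) lborel_affine[of c 0])
      (simp_all add: nn_integral_density nn_integral_distr nn_integral_cmult n_def)
  also have "\<dots> \<le> emeasure hyp_volume (ball (hyp_origin :: 'n hyperbolic) R)"
    unfolding F_def by (rule hyp_volume_ball_ge) fact
  finally have "ennreal (s ^ (n - 1)) * (ennreal (c ^ (n - 1)) * emeasure hyp_volume (cball (hyp_origin :: 'n hyperbolic) r))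
      \<le> ennreal (s ^ (n - 1)) * emeasure hyp_volume (ball (hyp_origin :: 'n hyperbolic) R)"
    by (intro mult_left_mono) auto
  moreover have "ennreal (s ^ (n - 1)) * ennreal (c ^ (n - 1)) = 1"
    using assms by (simp add: ennreal_mult'[symmetric] c_def power_mult_distrib[symmetric] power_one_over)
  ultimately show ?thesis by (simp add: mult.assoc[symmetric] n_def)
qed

section \<open>Spherical codes\<close>

lemma cos_le_half:
  assumes "pi / 3 \<le> \<theta>" "\<theta> \<le> pi"
  shows "cos \<theta> \<le> 1 / 2"
  using cos_monotone_0_pi_le[of "pi / 3" \<theta>] assms by (simp add: cos_60)

text \<open>Unit vectors with inner product at most 1/2 are at distance at least 1, so each ball of
  radius 1/2 in a finite cover holds at most one. The bound gives \<open>GREATEST\<close> in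
  \<open>max_code_size\<close> its meaning.\<close>

lemma spherical_codes_bounded:
  assumes "cos \<theta> \<le> 1 / 2"
  shows "\<exists>N. \<forall>C \<in> (spherical_codes \<theta> :: (real^'n::finite) set set). card C \<le> N"
proof -
  obtain K :: "(real^'n) set" where K: "finite K" "sphere 0 1 \<subseteq> (\<Union>x\<in>K. ball x (1 / 2))"
    using compact_sphere[of "0 :: real^'n" 1] unfolding compact_eq_totally_bounded
    by (meson half_gt_zero zero_less_one)
  have "card C \<le> card K" if C: "C \<in> spherical_codes \<theta>" for C :: "(real^'n) set"
  proof -
    have "\<forall>x\<in>C. \<exists>k\<in>K. dist k x < 1 / 2"
      using C K(2) by (auto simp: spherical_codes_def subset_iff)
    then obtain f where f: "\<And>x. x \<in> C \<Longrightarrow> f x \<in> K \<and> dist (f x) x < 1 / 2" by metis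
    have "inj_on f C"
    proof (rule inj_onI, rule ccontr)
      fix x y assume xy: "x \<in> C" "y \<in> C" "f x = f y" "x \<noteq> y"
      have "norm (x - y) < 1"
        using f[OF xy(1)] f[OF xy(2)] xy(3) dist_triangle2[of x y "f x"]
        by (simp add: dist_commute dist_norm[symmetric])
      then have "(norm (x - y))\<^sup>2 < 1" by (simp add: power_less_one_iff)
      moreover have "norm x = 1" "norm y = 1" "x \<bullet> y \<le> 1 / 2"
        using C xy assms by (force simp: spherical_codes_def pairwise_def)+
      ultimately show False
        by (simp add: power2_norm_eq_inner inner_diff inner_commute norm_eq_1)
    qed
    then show ?thesis using f K(1) by (intro card_inj_on_le[of f]) auto
  qed
  then show ?thesis by blast
qed

lemma card_le_max_code_size:
  fixes C :: "(real^'n::finite) set"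
  assumes "cos \<theta> \<le> 1 / 2" "C \<in> spherical_codes \<theta>" "finite C"
  shows "card C \<le> max_code_size TYPE('n) \<theta>"
proof -
  obtain N where "\<forall>C \<in> (spherical_codes \<theta> :: (real^'n) set set). card C \<le> N"
    using spherical_codes_bounded[OF assms(1)] by blast
  then show ?thesis
    unfolding max_code_size_def using assms by (intro Greatest_le_nat[of _ _ N]) auto
qed

lemma max_code_size_pos:
  assumes "cos \<theta> \<le> 1 / 2"
  shows "max_code_size TYPE('n::finite) \<theta> \<ge> 1"
proof -
  obtain i :: 'n where True by blast
  have "{axis i 1 :: real^'n} \<in> spherical_codes \<theta>"
    by (simp add: spherical_codes_def norm_axis_1)
  then show ?thesis using card_le_max_code_size[OF assms, of "{axis i 1 :: real^'n}"] by simp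
qed

text \<open>With \<open>x = sinh a\<close> and \<open>y = sinh b\<close> this is the law of cosines with \<open>cos \<phi> = \<kappa>\<close>: the hyperbolic
  cosine of the third side is convex as a function of either leg, so it is longest at a corner of the square, and
  \<open>\<kappa> \<le> 1/2\<close> makes \<open>(S, S)\<close> the best corner.\<close>

lemma sqrt_product_le:
  fixes x y S \<kappa> :: real
  assumes "0 \<le> x" "0 \<le> y" "x \<le> S" "y \<le> S" "\<kappa> \<le> 1 / 2"
  shows "sqrt (1 + x\<^sup>2) * sqrt (1 + y\<^sup>2) \<le> 1 + (1 - \<kappa>) * S\<^sup>2 + \<kappa> * (x * y)"
proof -
  have *: "sqrt (1 + x\<^sup>2) * sqrt (1 + y\<^sup>2) \<le> 1 + (1 - \<kappa>) * S\<^sup>2 + \<kappa> * (x * y)"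
    if a: "0 \<le> y" "y \<le> x" "x \<le> S" for x y
  proof (cases "\<kappa> \<le> 0")
    case True
    have "sqrt (1 + x\<^sup>2) * sqrt (1 + y\<^sup>2) \<le> sqrt (1 + S\<^sup>2) * sqrt (1 + S\<^sup>2)"
      using a by (intro mult_mono real_sqrt_le_mono add_left_mono power_mono) auto
    also have "\<dots> = 1 + S\<^sup>2" by simp
    also have "\<dots> \<le> 1 + (1 - \<kappa>) * S\<^sup>2 + \<kappa> * (x * y)"
    proof -
      have "x * y \<le> S * S" using a by (intro mult_mono) auto
      then have "\<kappa> * (S * S) \<le> \<kappa> * (x * y)" using True by (rule mult_left_mono_neg)
      then show ?thesis by (simp add: algebra_simps power2_eq_square)
    qed
    finally show ?thesis .
  next
    case False
    \<comment> \<open>The case \<kappa> = 1/2 of the claim, with the larger leg \<open>x\<close> in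
      place of \<open>S\<close>. After squaring it splits into \<open>y\<^sup>2 \<le> x * y\<close>
      and y <= (x + y) / 2.\<close>
    have "sqrt (1 + x\<^sup>2) * sqrt (1 + y\<^sup>2) \<le> 1 + x * (x + y) / 2"
    proof -
      have "y\<^sup>2 \<le> x * y" using a by (simp add: power2_eq_square mult_right_mono)
      moreover have "x\<^sup>2 * y\<^sup>2 \<le> x\<^sup>2 * ((x + y) / 2)\<^sup>2"
        using a by (intro mult_left_mono power_mono) auto
      ultimately have "(1 + x\<^sup>2) * (1 + y\<^sup>2) \<le> (1 + x * (x + y) / 2)\<^sup>2"
        by (simp add: power2_eq_square field_simps)
      then have "sqrt ((1 + x\<^sup>2) * (1 + y\<^sup>2)) \<le> 1 + x * (x + y) / 2"
        using a by (intro real_le_lsqrt) auto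
      then show ?thesis by (simp add: real_sqrt_mult)
    qed
    \<comment> \<open>The bound equals 1 + x^2 - x (x - y) / 2, so lowering \<kappa> from 1/2 only
      weakens it.\<close>
    also have "\<dots> \<le> 1 + x\<^sup>2 - \<kappa> * (x * (x - y))"
    proof -
      have "0 \<le> x * (x - y)" using a by simp
      then have "\<kappa> * (x * (x - y)) \<le> 1 / 2 * (x * (x - y))" using assms(5) by (intro mult_right_mono)
      then show ?thesis by (simp add: field_simps power2_eq_square)
    qed
    also have "\<dots> = 1 + (1 - \<kappa>) * x\<^sup>2 + \<kappa> * (x * y)"
      by (simp add: algebra_simps power2_eq_square)
    also have "\<dots> \<le> 1 + (1 - \<kappa>) * S\<^sup>2 + \<kappa> * (x * y)"
      using a assms(5) by (intro add_right_mono add_left_mono mult_left_mono power_mono) auto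
    finally show ?thesis .
  qed
  show ?thesis
    using *[of y x] *[of x y] assms by (cases "y \<le> x") (auto simp: mult.commute)
qed

section \<open>Directions of centers as a spherical code\<close>

definition direction :: "'n::finite hyperbolic \<Rightarrow> real^'n" where
  "direction x = fst (Rep_hyperbolic x) /\<^sub>R norm (fst (Rep_hyperbolic x))"

lemma snd_Rep_eq: "snd (Rep_hyperbolic x) = sqrt (1 + (norm (fst (Rep_hyperbolic x)))\<^sup>2)"
  using minkowski_Rep_self[of x] less_imp_le[OF snd_Rep_pos[of x]]
  by (intro real_sqrt_unique[symmetric]) (auto simp: minkowski_self)

lemma cosh_dist_origin: "cosh (dist hyp_origin x) = snd (Rep_hyperbolic x)"
  by (simp add: cosh_dist_hyperbolic minkowski_def)

lemma norm_fst_Rep_eq: "norm (fst (Rep_hyperbolic x)) = sinh (dist hyp_origin x)"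
proof -
  have "(norm (fst (Rep_hyperbolic x)))\<^sup>2 = (sinh (dist hyp_origin x))\<^sup>2"
    using cosh_square_eq[of "dist hyp_origin x"] unfolding cosh_dist_origin snd_Rep_eq by simp
  then show ?thesis by (rule power2_eq_imp_eq) auto
qed

text \<open>The equation for \<kappa> says that two points at distance \<open>R\<close> from the
  origin, seen under an angle of cosine \<kappa>, are exactly \<open>2 * r\<close> apart, since cosh
  (2 r) = 1 + 2 (sinh r)^2. By \<open>sqrt_product_le\<close>, a larger cosine would bring the
  points closer than that.\<close>

lemma direction_inner_le:
  fixes x y :: "'n::finite hyperbolic"
  assumes "x \<noteq> hyp_origin" "y \<noteq> hyp_origin" and R: "dist hyp_origin x \<le> R" "dist hyp_origin y \<le> R"
    and "2 * r \<le> dist x y" "r > 0" "\<kappa> \<le> 1 / 2"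
    and \<kappa>: "(1 - \<kappa>) * (sinh R)\<^sup>2 = 2 * (sinh r)\<^sup>2"
  shows "direction x \<bullet> direction y \<le> \<kappa>"
proof -
  define X Y where "X = norm (fst (Rep_hyperbolic x))" and "Y = norm (fst (Rep_hyperbolic y))"
  have XY: "0 < X" "0 < Y" "X \<le> sinh R" "Y \<le> sinh R"
    unfolding X_def Y_def norm_fst_Rep_eq using assms by auto
  have "1 + 2 * (sinh r)\<^sup>2 = cosh (2 * r)"
    by (simp add: cosh_double cosh_square_eq)
  also have "\<dots> \<le> cosh (dist x y)"
    using assms by (subst cosh_real_nonneg_le_iff) auto
  also have "\<dots> = sqrt (1 + X\<^sup>2) * sqrt (1 + Y\<^sup>2) - fst (Rep_hyperbolic x) \<bullet> fst (Rep_hyperbolic y)"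
    by (simp add: cosh_dist_hyperbolic minkowski_def snd_Rep_eq X_def Y_def)
  also have "\<dots> \<le> 1 + (1 - \<kappa>) * (sinh R)\<^sup>2 + \<kappa> * (X * Y) - fst (Rep_hyperbolic x) \<bullet> fst (Rep_hyperbolic y)"
    using XY assms by (intro diff_right_mono sqrt_product_le) auto
  finally have "fst (Rep_hyperbolic x) \<bullet> fst (Rep_hyperbolic y) \<le> \<kappa> * (X * Y)"
    unfolding \<kappa> by simp
  then show ?thesis
    using XY by (simp add: direction_def X_def[symmetric] Y_def[symmetric] field_simps)
qed

lemma centers_dist_ge:
  fixes P :: "'n::finite hyperbolic set set"
  assumes "P \<in> dense_packings r" "r > 0" "x \<in> centers r P" "y \<in> centers r P" "x \<noteq> y"
  shows "dist x y \<ge> 2 * r"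
proof -
  have "cball x r \<noteq> cball y r" using cball_hyperbolic_inject[of x r y] assms by auto
  then have "interior (cball x r) \<inter> interior (cball y r) = {}"
    using assms by (auto simp: dense_packings_def centers_def pairwise_def)
  then show ?thesis using disjoint_cballs_dist_ge assms by blast
qed

lemma card_centers_ball_le:
  fixes P :: "'n::finite hyperbolic set set"
  assumes P: "P \<in> dense_packings r" and r: "r > 0" and \<theta>: "pi / 3 \<le> \<theta>" "\<theta> \<le> pi"
    and R: "R > 0" "sinh R = sinh r / sin (\<theta> / 2)"
  shows "emeasure (count_space UNIV) (centers r P \<inter> ball hyp_origin R) \<le> of_nat (max_code_size TYPE('n) \<theta>)"
proof -
  define \<kappa> where "\<kappa> = cos \<theta>"
  have \<kappa>: "\<kappa> \<le> 1 / 2" using cos_le_half[OF \<theta>] by (simp add: \<kappa>_def)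
  have "0 < \<theta> / 2" "\<theta> / 2 < pi" using \<theta> pi_gt_zero by linarith+
  then have s: "sin (\<theta> / 2) > 0" by (rule sin_gt_zero)
  have half: "1 - \<kappa> = 2 * (sin (\<theta> / 2))\<^sup>2"
    using cos_double_sin[of "\<theta> / 2"] by (simp add: \<kappa>_def)
  have \<kappa>R: "(1 - \<kappa>) * (sinh R)\<^sup>2 = 2 * (sinh r)\<^sup>2"
    using s by (simp add: half R power_divide)
  \<comment> \<open>Leads to \<open>R \<le> 2 * r\<close> through sinh (2 r) = 2 sinh r cosh r >= 2
    sinh r.\<close>
  have "1 / 2 \<le> sin (\<theta> / 2)"
  proof (rule power2_le_imp_le)
    show "(1 / 2)\<^sup>2 \<le> (sin (\<theta> / 2))\<^sup>2" using half \<kappa> by (simp add: power_divide)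
  qed (use s in simp)
  then have "sinh R \<le> 2 * sinh r"
    using r s unfolding R by (simp add: field_simps mult_right_mono)
  also have "\<dots> \<le> 2 * sinh r * cosh r"
    using r cosh_real_ge_1[of r] by simp
  also have "\<dots> = sinh (2 * r)" by (simp add: sinh_double)
  finally have R2: "R \<le> 2 * r" by simp
  \<comment> \<open>Finiteness of the set of centers in the ball is not known beforehand; a uniform
    bound on its finite subsets yields it together with the count.\<close>
  have card: "card F \<le> max_code_size TYPE('n) \<theta>"
    if F: "F \<subseteq> centers r P \<inter> ball hyp_origin R" "finite F" for F
  proof (cases "hyp_origin \<in> F")
    \<comment> \<open>Here \<open>direction hyp_origin\<close> is the zero vector and no code
      arises. As \<open>R \<le> 2 * r\<close> and the ball is open, there is no second center, and a
      code of size 1 always exists.\<close>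
    case True
    have "y = hyp_origin" if "y \<in> F" for y
    proof (rule ccontr)
      assume "y \<noteq> hyp_origin"
      then have "dist hyp_origin y \<ge> 2 * r"
        using centers_dist_ge[OF P r, of hyp_origin y] F True that by auto
      then show False using F that R2 by auto
    qed
    then have "F = {hyp_origin}" using True by auto
    then show ?thesis using max_code_size_pos[of \<theta>, where 'n = 'n] \<kappa> by (simp add: \<kappa>_def)
  next
    case False
    have dir: "direction x \<bullet> direction y \<le> \<kappa>" if "x \<in> F" "y \<in> F" "x \<noteq> y" for x y
      by (rule direction_inner_le[OF _ _ _ _ _ r \<kappa> \<kappa>R])
        (use centers_dist_ge[OF P r, of x y] that F False in \<open>auto intro: less_imp_le\<close>)
    have norm: "norm (direction x) = 1" if "x \<in> F" for x
    proof -
      have "norm (fst (Rep_hyperbolic x)) > 0" unfolding norm_fst_Rep_eq using that False by auto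
      then show ?thesis by (simp add: direction_def)
    qed
    have inj: "inj_on direction F"
    proof (rule inj_onI, rule ccontr)
      fix x y assume "x \<in> F" "y \<in> F" "direction x = direction y" "x \<noteq> y"
      then show False using dir[of x y] norm[of y] \<kappa> by (simp add: norm_eq_1)
    qed
    have "direction ` F \<in> spherical_codes \<theta>"
      using norm dir by (auto simp: spherical_codes_def pairwise_def \<kappa>_def)
    then have "card (direction ` F) \<le> max_code_size TYPE('n) \<theta>"
      using \<kappa> F by (intro card_le_max_code_size) (auto simp: \<kappa>_def)
    then show ?thesis using inj by (simp add: card_image)
  qed
  then have "finite (centers r P \<inter> ball hyp_origin R)
      \<and> card (centers r P \<inter> ball hyp_origin R) \<le> max_code_size TYPE('n) \<theta>"
    by (intro finite_if_finite_subsets_card_bdd) auto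
  then show ?thesis by (simp add: emeasure_count_space)
qed

section \<open>Intensity of a random packing\<close>

lemma hyp_isometries_bij: "g \<in> hyp_isometries \<Longrightarrow> bij g"
  and hyp_isometries_dist: "g \<in> hyp_isometries \<Longrightarrow> dist (g x) (g y) = dist x y"
  by (auto simp: hyp_isometries_def)

lemma continuous_on_hyp_isometry:
  assumes "g \<in> hyp_isometries"
  shows "continuous_on A g"
  unfolding continuous_on_iff hyp_isometries_dist[OF assms] by blast

lemma hyp_isometry_vimage_borel:
  assumes "g \<in> hyp_isometries" "B \<in> sets borel"
  shows "g -` B \<in> sets borel"
  by (rule measurable_sets_borel[OF _ assms(2)])
    (intro borel_measurable_continuous_onI continuous_on_hyp_isometry assms)

lemma hyp_isometry_image_cball:
  assumes "g \<in> hyp_isometries"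
  shows "g ` cball x r = cball (g x) r"
proof (intro equalityI subsetI)
  fix y assume "y \<in> cball (g x) r"
  moreover obtain z where "y = g z" using hyp_isometries_bij[OF assms] by (metis bij_pointE)
  ultimately show "y \<in> g ` cball x r" by (auto simp: hyp_isometries_dist[OF assms])
qed (auto simp: hyp_isometries_dist[OF assms])

lemma hyp_isometry_interior_image:
  assumes "g \<in> hyp_isometries"
  shows "interior (g ` B) \<subseteq> g ` interior B"
proof
  fix y assume "y \<in> interior (g ` B)"
  then obtain V where V: "open V" "y \<in> V" "V \<subseteq> g ` B" by (auto simp: interior_def)
  obtain z where z: "y = g z" using hyp_isometries_bij[OF assms] by (metis bij_pointE)
  have "open (g -` V)"
    using V continuous_on_hyp_isometry[OF assms, of UNIV] by (simp add: continuous_on_open_vimage)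
  moreover have "g -` V \<subseteq> B"
    using V(3) bij_is_inj[OF hyp_isometries_bij[OF assms]] by (auto simp: inj_def)
  ultimately have "z \<in> interior B" using V z by (auto simp: interior_def)
  then show "y \<in> g ` interior B" using z by blast
qed

lemma image_dense_packings:
  assumes g: "g \<in> hyp_isometries" and P: "P \<in> dense_packings r"
  shows "(`) g ` P \<in> dense_packings r"
proof -
  have "(`) g ` P \<subseteq> range (\<lambda>x. cball x r)"
  proof safe
    fix B assume "B \<in> P"
    then obtain x where "B = cball x r" using P by (auto simp: dense_packings_def)
    then show "g ` B \<in> range (\<lambda>x. cball x r)" using hyp_isometry_image_cball[OF g] by blast
  qed
  moreover have "pairwise (\<lambda>B C. interior B \<inter> interior C = {}) ((`) g ` P)"
  proof (rule pairwise_imageI)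
    fix B C assume BC: "B \<in> P" "C \<in> P" "B \<noteq> C"
    have "interior (g ` B) \<inter> interior (g ` C) \<subseteq> g ` interior B \<inter> g ` interior C"
      using hyp_isometry_interior_image[OF g] by blast
    also have "\<dots> = g ` (interior B \<inter> interior C)"
      by (rule image_Int[symmetric]) (rule bij_is_inj[OF hyp_isometries_bij[OF g]])
    also have "interior B \<inter> interior C = {}"
      using BC P by (auto simp: dense_packings_def pairwise_def)
    finally show "interior (g ` B) \<inter> interior (g ` C) = {}" by simp
  qed
  moreover have "\<exists>B\<in>(`) g ` P. cball x r \<inter> B \<noteq> {}" if x: "cball x r \<notin> (`) g ` P" for x
  proof -
    obtain z where z: "x = g z" using hyp_isometries_bij[OF g] by (metis bij_pointE)
    then have "cball z r \<notin> P" using x hyp_isometry_image_cball[OF g, of z r] by auto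
    then obtain B where "B \<in> P" "cball z r \<inter> B \<noteq> {}"
      using P unfolding dense_packings_def by blast
    then obtain w where w: "w \<in> cball z r" "w \<in> B" by blast
    then have "g w \<in> cball x r \<inter> g ` B" by (simp add: z hyp_isometries_dist[OF g])
    then show ?thesis using \<open>B \<in> P\<close> by (intro bexI[of _ "g ` B"] imageI) auto
  qed
  ultimately show ?thesis by (simp add: dense_packings_def)
qed

section \<open>Counting centers and the intensity measure\<close>

definition center_count :: "real \<Rightarrow> 'n::finite hyperbolic set \<Rightarrow> 'n hyperbolic set set \<Rightarrow> ennreal" where
  "center_count r B P = emeasure (count_space UNIV) (centers r P \<inter> B)"

lemma center_count_image:
  assumes g: "g \<in> hyp_isometries"
  shows "center_count r B ((`) g ` P) = center_count r (g -` B) P"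
proof -
  have inj: "inj g" using bij_is_inj[OF hyp_isometries_bij[OF g]] .
  have c: "g z \<in> centers r ((`) g ` P) \<longleftrightarrow> z \<in> centers r P" for z
    using hyp_isometry_image_cball[OF g, of z r, symmetric] inj
    by (auto simp: centers_def inj_image_eq_iff)
  have "bij_betw g (centers r P \<inter> g -` B) (centers r ((`) g ` P) \<inter> B)"
    unfolding bij_betw_def
  proof (intro conjI equalityI subsetI)
    fix y assume y: "y \<in> centers r ((`) g ` P) \<inter> B"
    obtain z where "y = g z" using hyp_isometries_bij[OF g] by (metis bij_pointE)
    then show "y \<in> g ` (centers r P \<inter> g -` B)" using y c by auto
  qed (use c inj in \<open>auto intro: inj_on_subset\<close>)
  then show ?thesis
    using bij_betw_finite bij_betw_same_card by (fastforce simp: center_count_def emeasure_count_space)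
qed

lemma packing_space_generator_subset:
  "{(\<lambda>P. emeasure (count_space UNIV) (centers r P \<inter> B)) -` A \<inter> dense_packings r | A B.
      A \<in> sets borel \<and> B \<in> sets borel} \<subseteq> Pow (dense_packings r)"
  by auto

lemma space_packing_space [simp]: "space (packing_space r) = dense_packings r"
  unfolding packing_space_def by (rule space_measure_of) auto

lemma measurable_center_count [measurable]:
  assumes "B \<in> sets borel"
  shows "center_count r B \<in> borel_measurable (packing_space r)"
proof (rule measurableI)
  fix A :: "ennreal set" assume "A \<in> sets borel"
  then show "center_count r B -` A \<inter> space (packing_space r) \<in> sets (packing_space r)"
    unfolding space_packing_space using assms unfolding packing_space_def center_count_def
    by (intro in_measure_of packing_space_generator_subset) auto
qed simp

text \<open>Pulling back a generator of the \<sigma>-algebra gives another generator, with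
  \<open>B\<close> replaced by its preimage under \<open>g\<close>.\<close>

lemma measurable_image_packing:
  fixes g :: "'n::finite hyperbolic \<Rightarrow> 'n hyperbolic"
  assumes g: "g \<in> hyp_isometries"
  shows "(\<lambda>P. (`) g ` P) \<in> measurable (packing_space r) (packing_space r)"
proof -
  have "(\<lambda>P. (`) g ` P) \<in> measurable (packing_space r) (sigma (dense_packings r :: 'n hyperbolic set set set)
     {(\<lambda>P. emeasure (count_space UNIV) (centers r P \<inter> B)) -` A \<inter> dense_packings r | A B.
        A \<in> sets borel \<and> B \<in> sets borel})"
  proof (rule measurable_measure_of[OF packing_space_generator_subset])
    show "(\<lambda>P. (`) g ` P) \<in> space (packing_space r) \<rightarrow> dense_packings r"
      using image_dense_packings[OF g] by auto
    fix Y :: "'n hyperbolic set set set" assume "Y \<in> {(\<lambda>P. emeasure (count_space UNIV) (centers r P \<inter> B)) -` A \<inter> dense_packings r | A B.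
        A \<in> sets borel \<and> B \<in> sets borel}"
    then obtain A :: "ennreal set" and B where
      Y: "Y = center_count r B -` A \<inter> dense_packings r" and AB: "A \<in> sets borel" "B \<in> sets borel"
      by (auto simp: center_count_def[abs_def])
    have "(\<lambda>P. (`) g ` P) -` Y \<inter> space (packing_space r)
        = center_count r (g -` B) -` A \<inter> space (packing_space r)"
      using image_dense_packings[OF g] center_count_image[OF g] by (auto simp: Y)
    also have "\<dots> \<in> sets (packing_space r)"
      by (rule measurable_sets[OF measurable_center_count[OF hyp_isometry_vimage_borel[OF g AB(2)]] AB(1)])
    finally show "(\<lambda>P. (`) g ` P) -` Y \<inter> space (packing_space r) \<in> sets (packing_space r)" .
  qed
  then show ?thesis by (simp only: packing_space_def[symmetric])
qed

definition intensity :: "real \<Rightarrow> 'n::finite hyperbolic set set measure \<Rightarrow> 'n hyperbolic measure" where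
  "intensity r \<mu> = measure_of UNIV (sets borel) (\<lambda>B. \<integral>\<^sup>+P. center_count r B P \<partial>\<mu>)"

lemma sets_intensity [simp]: "sets (intensity r \<mu>) = sets borel"
  unfolding intensity_def using sets.sigma_sets_eq[of "borel :: 'a hyperbolic measure"]
  by (subst sets_measure_of) auto

lemma emeasure_intensity:
  assumes \<mu>: "sets \<mu> = sets (packing_space r)" and B: "B \<in> sets borel"
  shows "emeasure (intensity r \<mu>) B = (\<integral>\<^sup>+P. center_count r B P \<partial>\<mu>)"
proof (rule emeasure_measure_of[OF intensity_def])
  have meas: "center_count r B \<in> borel_measurable \<mu>" if "B \<in> sets borel" for B
    unfolding measurable_cong_sets[OF \<mu> refl] by (rule measurable_center_count[OF that])
  show "countably_additive (sets (intensity r \<mu>)) (\<lambda>B. \<integral>\<^sup>+P. center_count r B P \<partial>\<mu>)"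
  proof (rule countably_additiveI)
    fix B :: "nat \<Rightarrow> _" assume B: "range B \<subseteq> sets (intensity r \<mu>)" "disjoint_family B"
    have "(\<Sum>i. \<integral>\<^sup>+P. center_count r (B i) P \<partial>\<mu>) = (\<integral>\<^sup>+P. (\<Sum>i. center_count r (B i) P) \<partial>\<mu>)"
      using B by (intro nn_integral_suminf[symmetric] meas) auto
    moreover have "(\<Sum>i. center_count r (B i) P) = center_count r (\<Union>(range B)) P" for P
      using B(2) unfolding center_count_def
      by (subst suminf_emeasure) (auto simp: disjoint_family_on_def)
    ultimately show "(\<Sum>i. \<integral>\<^sup>+P. center_count r (B i) P \<partial>\<mu>) = (\<integral>\<^sup>+P. center_count r (\<Union>(range B)) P \<partial>\<mu>)"
      by simp
  qed
qed (use B in \<open>auto simp: positive_def center_count_def\<close>)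

lemma intensity_ball_eq:
  assumes \<mu>: "\<mu> \<in> invariant_prob_measures r"
  shows "emeasure (intensity r \<mu>) (ball p \<rho>) = emeasure (intensity r \<mu>) (ball hyp_origin \<rho>)"
proof -
  define g where "g = hyp_boost (fst (Rep_hyperbolic p))"
  have g: "g \<in> hyp_isometries" and gp: "g hyp_origin = p"
    by (simp_all add: g_def hyp_boost_isometry hyp_boost_origin)
  have sets: "sets \<mu> = sets (packing_space r)" and inv: "distr \<mu> \<mu> (\<lambda>P. (`) g ` P) = \<mu>"
    using \<mu> g by (auto simp: invariant_prob_measures_def)
  have m: "(\<lambda>P. (`) g ` P) \<in> measurable \<mu> \<mu>"
    unfolding measurable_cong_sets[OF sets sets] by (rule measurable_image_packing[OF g])
  have c: "center_count r (ball p \<rho>) \<in> borel_measurable \<mu>"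
    unfolding measurable_cong_sets[OF sets refl] by (rule measurable_center_count) simp
  have "g -` ball p \<rho> = ball hyp_origin \<rho>"
    using hyp_isometries_dist[OF g] by (auto simp: gp[symmetric])
  then have "emeasure (intensity r \<mu>) (ball hyp_origin \<rho>)
      = (\<integral>\<^sup>+P. center_count r (ball p \<rho>) ((`) g ` P) \<partial>\<mu>)"
    by (simp add: emeasure_intensity[OF sets] center_count_image[OF g])
  also have "\<dots> = (\<integral>\<^sup>+P. center_count r (ball p \<rho>) P \<partial>distr \<mu> \<mu> (\<lambda>P. (`) g ` P))"
    by (subst nn_integral_distr[OF m]) (simp_all add: c)
  also have "\<dots> = emeasure (intensity r \<mu>) (ball p \<rho>)"
    by (simp add: inv emeasure_intensity[OF sets])
  finally show ?thesis by simp
qed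

text \<open>The origin is covered exactly when some center lies within \<open>r\<close> of it, and
  the probability that a count is nonzero is at most its expectation.\<close>

lemma packing_density_le_intensity:
  assumes \<mu>: "\<mu> \<in> invariant_prob_measures r"
  shows "packing_density \<mu> \<le> emeasure (intensity r \<mu>) (cball hyp_origin r)"
proof -
  have sets: "sets \<mu> = sets (packing_space r)" using \<mu> by (simp add: invariant_prob_measures_def)
  have sp: "space \<mu> = dense_packings r" using sets_eq_imp_space_eq[OF sets] by simp
  let ?E = "{P \<in> space \<mu>. hyp_origin \<in> \<Union>P}"
  have le: "indicator ?E P \<le> center_count r (cball hyp_origin r) P" for P
  proof (cases "P \<in> ?E")
    case True
    then obtain x where x: "cball x r \<in> P" "hyp_origin \<in> cball x r"
      using sp by (auto simp: dense_packings_def)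
    have "center_count r {x} P \<le> center_count r (cball hyp_origin r) P"
      unfolding center_count_def using x by (intro emeasure_mono) (auto simp: dist_commute)
    moreover have "centers r P \<inter> {x} = {x}" using x by (auto simp: centers_def)
    ultimately show ?thesis using True by (simp add: center_count_def)
  qed simp
  show ?thesis
  \<comment> \<open>On a non-measurable event \<open>emeasure\<close> takes the value 0, which
    settles that case.\<close>
  proof (cases "?E \<in> sets \<mu>")
    case True
    then have "packing_density \<mu> = (\<integral>\<^sup>+P. indicator ?E P \<partial>\<mu>)"
      by (simp add: packing_density_def)
    also have "\<dots> \<le> (\<integral>\<^sup>+P. center_count r (cball hyp_origin r) P \<partial>\<mu>)"
      by (intro nn_integral_mono le)
    also have "\<dots> = emeasure (intensity r \<mu>) (cball hyp_origin r)"
      by (subst emeasure_intensity[OF sets]) auto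
    finally show ?thesis .
  qed (simp add: packing_density_def emeasure_notin_sets)
qed

section \<open>The density bound\<close>

theorem theorem4p1:
  fixes \<theta> r :: real
  assumes "CARD('n::finite) \<ge> 2"
    and "pi / 3 \<le> \<theta>" and "\<theta> \<le> pi"
    and "r > 0"
  shows "optimal_packing_density TYPE('n) r
           \<le> ennreal (sin (\<theta> / 2) ^ (CARD('n) - 1) * real (max_code_size TYPE('n) \<theta>))"
  unfolding optimal_packing_density_def
proof (rule SUP_least)
  fix \<mu> :: "'n hyperbolic set set measure" assume \<mu>: "\<mu> \<in> invariant_prob_measures r"
  define s A R where "s = sin (\<theta> / 2)" and "A = max_code_size TYPE('n) \<theta>" and "R = arsinh (sinh r / s)"
  have "0 < \<theta> / 2" "\<theta> / 2 < pi" using assms pi_gt_zero by linarith+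
  then have s: "0 < s" "s \<le> 1" unfolding s_def by (auto intro: sin_gt_zero)
  have R: "sinh R = sinh r / s" by (simp add: R_def)
  then have "R > 0" using s \<open>r > 0\<close> by (metis divide_pos_pos sinh_real_pos_iff)
  let ?N = "intensity r \<mu>" and ?M = "hyp_volume :: 'n hyperbolic measure" and ?o = "hyp_origin :: 'n hyperbolic"
  have sets: "sets \<mu> = sets (packing_space r)" and "prob_space \<mu>"
    using \<mu> by (auto simp: invariant_prob_measures_def)
  interpret prob_space \<mu> by fact
  have NR: "emeasure ?N (ball ?o R) \<le> of_nat A"
  proof -
    have "emeasure ?N (ball ?o R) = (\<integral>\<^sup>+P. center_count r (ball ?o R) P \<partial>\<mu>)"
      by (simp add: emeasure_intensity[OF sets])
    also have "\<dots> \<le> (\<integral>\<^sup>+P. of_nat A \<partial>\<mu>)"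
      unfolding center_count_def A_def using sets_eq_imp_space_eq[OF sets]
      by (intro nn_integral_mono card_centers_ball_le) (use assms \<open>R > 0\<close> R in \<open>auto simp: s_def\<close>)
    also have "\<dots> = of_nat A" by (simp add: emeasure_space_1)
    finally show ?thesis .
  qed
  \<comment> \<open>The choice \<delta> = \<open>R\<close> is what \<open>NR\<close> permits: it
    bounds the expected number of centers in every ball of radius at most \<open>R\<close>.\<close>
  have cross: "emeasure ?N (ball ?o r') * emeasure ?M (ball ?o R)
      \<le> emeasure ?M (ball ?o r') * emeasure ?N (ball ?o R)" for r'
  proof (rule uniformly_distributed_cross_le[where \<delta> = R and h = "\<lambda>\<rho>. emeasure ?M (ball ?o \<rho>)"
        and g = "\<lambda>\<rho>. emeasure ?N (ball ?o \<rho>)"])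
    fix \<rho> assume "0 < \<rho>" "\<rho> \<le> R"
    then have "emeasure ?N (ball ?o \<rho>) \<le> emeasure ?N (ball ?o R)"
      by (intro emeasure_mono) auto
    also note NR
    also have "of_nat A < (\<infinity> :: ennreal)" by (simp add: ennreal_of_nat_eq_real_of_nat)
    finally show "emeasure ?N (ball ?o \<rho>) < \<infinity>" .
    show "emeasure ?M (ball x \<rho>) = emeasure ?M (ball ?o \<rho>)" for x
      by (rule hyp_volume_ball_eq)
    show "emeasure ?N (ball x \<rho>) = emeasure ?N (ball ?o \<rho>)" for x
      by (rule intensity_ball_eq[OF \<mu>])
    show "0 < emeasure ?M (ball ?o \<rho>) \<and> emeasure ?M (ball ?o \<rho>) < \<infinity>"
      using \<open>0 < \<rho>\<close> by (intro conjI hyp_volume_ball_pos hyp_volume_ball_finite)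
  qed (simp_all add: \<open>R > 0\<close>)
  \<comment> \<open>Open balls shrinking to the closed ball of radius \<open>r\<close>. The limit is
    taken on the \<open>?M\<close> side alone; on the \<open>?N\<close> side monotonicity is
    enough.\<close>
  define V where "V k = ball ?o (r + 1 / real (Suc k))" for k
  have V_sup: "cball ?o r \<subseteq> V k" for k
  proof -
    have "0 < 1 / real (Suc k)" by simp
    then have "r < r + 1 / real (Suc k)" by linarith
    then show ?thesis unfolding V_def ball_def cball_def by (blast intro: le_less_trans)
  qed
  have "(\<Inter>k. V k) = cball ?o r"
  proof safe
    fix x assume x: "x \<in> (\<Inter>k. V k)"
    have "dist ?o x \<le> r + e" if e: "e > 0" for e
    proof -
      obtain k where "inverse (real (Suc k)) < e" using reals_Archimedean[OF e] by blast
      moreover have "dist ?o x < r + 1 / real (Suc k)" using x by (auto simp: V_def)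
      ultimately show ?thesis by (simp add: inverse_eq_divide)
    qed
    then show "x \<in> cball ?o r" by (simp add: field_le_epsilon)
  next
    fix x k assume "x \<in> cball ?o r"
    then show "x \<in> V k" using V_sup by blast
  qed
  moreover have "(\<lambda>k. emeasure ?M (V k)) \<longlonglongrightarrow> emeasure ?M (\<Inter>k. V k)"
  proof (rule Lim_emeasure_decseq)
    show "decseq V"
    proof (rule decseq_SucI, unfold V_def, rule subset_ball)
      show "r + 1 / real (Suc (Suc k)) \<le> r + 1 / real (Suc k)" for k
        by (simp add: frac_le)
    qed
    show "emeasure ?M (V k) \<noteq> \<infinity>" for k using hyp_volume_ball_finite by (simp add: V_def less_top)
  qed (auto simp: V_def)
  ultimately have "(\<lambda>k. emeasure ?M (V k)) \<longlonglongrightarrow> emeasure ?M (cball ?o r)" by simp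
  then have lim: "(\<lambda>k. of_nat A * emeasure ?M (V k)) \<longlonglongrightarrow> of_nat A * emeasure ?M (cball ?o r)"
    by (intro ennreal_tendsto_cmult) (simp add: ennreal_of_nat_eq_real_of_nat)
  have "emeasure ?M (ball ?o R) * emeasure ?N (cball ?o r) \<le> of_nat A * emeasure ?M (V k)" for k
  proof -
    have "emeasure ?N (cball ?o r) \<le> emeasure ?N (V k)"
      by (intro emeasure_mono V_sup) (simp add: V_def)
    then have "emeasure ?M (ball ?o R) * emeasure ?N (cball ?o r) \<le> emeasure ?N (V k) * emeasure ?M (ball ?o R)"
      by (simp add: mult.commute mult_left_mono)
    also have "\<dots> \<le> emeasure ?M (V k) * emeasure ?N (ball ?o R)"
      unfolding V_def by (rule cross)
    also have "\<dots> \<le> emeasure ?M (V k) * of_nat A"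
      by (intro mult_left_mono NR) simp
    finally show ?thesis by (simp add: mult.commute)
  qed
  then have "emeasure ?M (ball ?o R) * emeasure ?N (cball ?o r) \<le> of_nat A * emeasure ?M (cball ?o r)"
    by (intro LIMSEQ_le_const[OF lim]) blast
  also have "\<dots> \<le> of_nat A * (ennreal (s ^ (CARD('n) - 1)) * emeasure ?M (ball ?o R))"
    by (intro mult_left_mono hyp_volume_ball_ratio assms \<open>R > 0\<close> s R) simp
  finally have "emeasure ?M (ball ?o R) * emeasure ?N (cball ?o r)
      \<le> emeasure ?M (ball ?o R) * (ennreal (s ^ (CARD('n) - 1)) * of_nat A)"
    by (simp add: mult_ac)
  \<comment> \<open>The volume of the ball of radius \<open>R\<close> is positive and finite, hence
    cancels in \<open>ennreal\<close>.\<close>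
  then have "emeasure ?N (cball ?o r) \<le> ennreal (s ^ (CARD('n) - 1)) * of_nat A"
    using hyp_volume_ball_pos[OF \<open>R > 0\<close>, where 'n = 'n] hyp_volume_ball_finite[of R, where 'n = 'n]
    by (subst (asm) ennreal_mult_le_mult_iff) auto
  also have "\<dots> = ennreal (s ^ (CARD('n) - 1) * real A)"
    using s by (simp add: ennreal_mult' ennreal_of_nat_eq_real_of_nat)
  finally show "packing_density \<mu> \<le> ennreal (sin (\<theta> / 2) ^ (CARD('n) - 1) * real (max_code_size TYPE('n) \<theta>))"
    using packing_density_le_intensity[OF \<mu>] unfolding s_def A_def by order
qed

end
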